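(* For every positive integer $n$, \[\alpha(n)=\begin{cases}2n-1,& n\in\{1,2\},\\ 2n-2,& n\in\{3,4\},\\ 2n-3,& n>4.\end{cases}\]
   Context: A family $e_1,\dots,e_k$ of complex $n\times n$ matrices is called anticommuting if $e_ie_j=-e_je_i$ for all distinct $i,j\in\{1,\dots,k\}$. For a positive integer $n$, $\alpha(n)$ denotes the largest $k$ such that there exists an anticommuting family $e_1,\dots,e_k\in\mathbb{C}^{n\times n}$ with $e_1^2,\dots,e_k^2\neq 0$. *)

theory Defs
  imports "Jordan_Normal_Form.Matrix"
begin

definition anticomm_family :: "nat \<Rightarrow> nat \<Rightarrow> (nat \<Rightarrow> complex mat) \<Rightarrow> bool" where
  "anticomm_family n k e \<longleftrightarrow>
     (\<forall>i<k. e i \<in> carrier_mat n n \<and> e i * e i \<noteq> 0\<^sub>m n n) \<and>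
     (\<forall>i<k. \<forall>j<k. i \<noteq> j \<longrightarrow> e i * e j = - (e j * e i))"

definition alpha :: "nat \<Rightarrow> nat" where
  "alpha n = (GREATEST k. \<exists>e. anticomm_family n k e)"

end

theory Submission
  imports Defs "Jordan_Normal_Form.Schur_Decomposition"
begin

text \<open>
  Upper bound, by strong induction on \<open>n\<close>. The squares \<open>e\<^sub>i\<^sup>2\<close> commute with the whole family, so if some
  \<open>e\<^sub>i\<^sup>2\<close> has two different eigenvalues, its Fitting decomposition splits the family into two families
  of smaller size. Otherwise every \<open>e\<^sub>i\<close> is nilpotent or invertible. A family of nilpotent matrices has
  at most \<open>2n - 4\<close> members, because generic vectors \<open>u\<close>, \<open>v\<close> turn it into orthogonal non-isotropic
  vectors \<open>(u e\<^sub>i, e\<^sub>i v)\<close> of a hyperbolic space of dimension \<open>2n\<close>, all orthogonal to a totally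
  isotropic plane. With one invertible member this gives \<open>2n - 3\<close>. If \<open>E\<close>, \<open>F\<close> are two invertible
  members, the products \<open>E F e\<^sub>i\<close> restrict to an anticommuting family on a generalised eigenspace of \<open>E\<close>, of
  dimension at most \<open>n / 2\<close>.

  Lower bound: Pauli matrices and direct sums for \<open>n \<le> 4\<close>; in general the \<open>2n - 4\<close> matrices
  \<open>E\<^sub>1\<^sub>l \<plusminus> E\<^sub>l\<^sub>n\<close> with \<open>1 < l < n\<close>, together with \<open>diag(1, -1, \<dots>, -1, 1)\<close>.
\<close>

section \<open>Homogeneous systems and generic vectors\<close>

text \<open>Gaussian elimination by induction on the equations: unless equation \<open>l\<close> is
  void, a pivot unknown \<open>p\<close> is eliminated and recovered at the end. Read by rows, more
  vectors than coordinates are linearly dependent.\<close>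

lemma homogeneous_system_nontrivial_solution:
  fixes a :: "'i \<Rightarrow> 'j \<Rightarrow> 'a :: field"
  assumes "finite J" "finite I" "card J < card I"
  shows "\<exists>c. (\<exists>i\<in>I. c i \<noteq> 0) \<and> (\<forall>j\<in>J. (\<Sum>i\<in>I. c i * a i j) = 0)"
  using assms
proof (induction J arbitrary: I a rule: finite_induct)
  case empty
  then obtain i where "i \<in> I" by fastforce
  then show ?case by (intro exI[of _ "\<lambda>_. 1"]) auto
next
  case (insert l J)
  show ?case
  proof (cases "\<forall>i\<in>I. a i l = 0")
    case True
    have "card J < card I" using insert by simp
    from insert.IH[OF insert.prems(1) this, of a] True show ?thesis by auto
  next
    case False
    then obtain p where p: "p \<in> I" "a p l \<noteq> 0" by auto
    define a' where "a' = (\<lambda>i j. a i j - a i l / a p l * a p j)"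
    have "finite (I - {p})" "card J < card (I - {p})" using insert p by auto
    from insert.IH[OF this, of a'] obtain c i
      where c: "i \<in> I" "i \<noteq> p" "c i \<noteq> 0"
        "\<And>j. j \<in> J \<Longrightarrow> (\<Sum>i\<in>I - {p}. c i * a' i j) = 0" by auto
    define s where "s = (\<Sum>i\<in>I - {p}. c i * a i l)"
    \<comment> \<open>The value at \<open>p\<close> is forced by equation \<open>l\<close>; the full
      sums over \<open>I\<close> then agree with those of the reduced system
      \<open>a'\<close>.\<close>
    define c' where "c' = c(p := - s / a p l)"
    have sum': "(\<Sum>i\<in>I. c' i * a i j) = (\<Sum>i\<in>I - {p}. c i * a i j) - s / a p l * a p j" for j
      using p insert.prems(1) by (simp add: sum.remove[of _ p] c'_def)
    have "(\<Sum>i\<in>I. c' i * a i j) = 0" if "j \<in> J" for j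
    proof -
      have "(\<Sum>i\<in>I - {p}. c i * a' i j)
          = (\<Sum>i\<in>I - {p}. c i * a i j) - s * (1 / a p l * a p j)"
        unfolding a'_def s_def sum_distrib_right sum_subtractf[symmetric]
        by (intro sum.cong) (auto simp: algebra_simps)
      then show ?thesis using c(4)[OF that] unfolding sum' by simp
    qed
    moreover have "(\<Sum>i\<in>I. c' i * a i l) = 0"
      unfolding sum' using p by (simp add: s_def)
    moreover have "c' i \<noteq> 0" using c by (simp add: c'_def)
    ultimately show ?thesis using c(1) by auto
  qed
qed

text \<open>If \<open>s > r\<close>, then \<open>Q\<close> has a nonzero kernel vector
  \<open>y\<close>, which \<open>C * Q = 1\<close> would have to fix. This serves to compare the
  sizes of two generalised eigenspaces.\<close>

lemma right_inverse_imp_le_dim: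
  fixes C :: "'a :: field mat"
  assumes C: "C \<in> carrier_mat s r" and Q: "Q \<in> carrier_mat r s" and CQ: "C * Q = 1\<^sub>m s"
  shows "s \<le> r"
proof (rule ccontr)
  assume "\<not> s \<le> r"
  then have "card {..<r} < card {..<s}" by simp
  from homogeneous_system_nontrivial_solution[OF _ _ this, of "\<lambda>i j. Q $$ (j, i)"]
  obtain c i where c: "i < s" "c i \<noteq> 0" "\<And>j. j < r \<Longrightarrow> (\<Sum>i<s. c i * Q $$ (j, i)) = 0" by auto
  define y where "y = vec s c"
  have "Q *\<^sub>v y = 0\<^sub>v r"
    using Q c(3) by (intro eq_vecI)
      (auto simp: y_def scalar_prod_def row_def atLeast0LessThan mult.commute)
  then have "C *\<^sub>v (Q *\<^sub>v y) = 0\<^sub>v s" using C by (auto intro!: eq_vecI)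
  then have "(C * Q) *\<^sub>v y = 0\<^sub>v s" using C Q by (simp add: y_def)
  then have "y = 0\<^sub>v s" unfolding CQ by (simp add: y_def)
  then have "y $ i = 0" using c(1) by simp
  then show False using c(1,2) by (simp add: y_def)
qed

lemma nonzero_mat_entry:
  assumes "A \<in> carrier_mat n m" "A \<noteq> 0\<^sub>m n m"
  shows "\<exists>i<n. \<exists>j<m. A $$ (i, j) \<noteq> 0"
proof (rule ccontr)
  assume "\<not> ?thesis"
  then have "A = 0\<^sub>m n m" using assms(1) by (intro eq_matI) auto
  then show False using assms(2) by simp
qed

text \<open>Kronecker substitution: with \<open>u b = t ^ b\<close> and
  \<open>v c = t ^ (n * c)\<close> each form becomes a nonzero polynomial in the single variable
  \<open>t\<close>, and some \<open>t\<close> avoids the finitely many roots.\<close>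

lemma generic_bilinear_nonzero:
  fixes A :: "'i \<Rightarrow> complex mat"
  assumes I: "finite I" and A: "\<And>i. i \<in> I \<Longrightarrow> A i \<in> carrier_mat n n \<and> A i \<noteq> 0\<^sub>m n n"
  shows "\<exists>u v. \<forall>i\<in>I. (\<Sum>b<n. \<Sum>c<n. u b * A i $$ (b, c) * v c) \<noteq> 0"
proof -
  define p where "p = (\<lambda>i. \<Sum>(b, c)\<in>{..<n} \<times> {..<n}. monom (A i $$ (b, c)) (b + n * c))"
  have p0: "p i \<noteq> 0" if i: "i \<in> I" for i
  proof -
    obtain b c where bc: "b < n" "c < n" "A i $$ (b, c) \<noteq> 0"
      using nonzero_mat_entry A[OF i] by blast
    \<comment> \<open>With \<open>b < n\<close>, the exponent \<open>b + n * c\<close> is a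
      base-\<open>n\<close> code of the pair, so distinct entries of \<open>A i\<close> go to
      distinct coefficients.\<close>
    have inj: "b' + n * c' = b + n * c \<longleftrightarrow> (b', c') = (b, c)" if "b' < n" for b' c'
    proof
      assume e: "b' + n * c' = b + n * c"
      then have "(b' + n * c') mod n = (b + n * c) mod n" "(b' + n * c') div n = (b + n * c) div n"
        by auto
      then show "(b', c') = (b, c)" using bc that by simp
    qed simp
    have "coeff (p i) (b + n * c)
        = (\<Sum>x\<in>{..<n} \<times> {..<n}. if x = (b, c) then A i $$ (b, c) else 0)"
      unfolding p_def coeff_sum by (intro sum.cong) (use inj in \<open>auto split: if_splits\<close>)
    also have "\<dots> = A i $$ (b, c)" using bc by (subst sum.delta) auto
    finally show ?thesis using bc by auto
  qed
  have "finite (\<Union>i\<in>I. {t. poly (p i) t = 0})" using I p0 by (auto intro: poly_roots_finite)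
  then obtain t where "t \<notin> (\<Union>i\<in>I. {t. poly (p i) t = 0})"
    using ex_new_if_finite infinite_UNIV_char_0 by blast
  moreover have "(\<Sum>b<n. \<Sum>c<n. t ^ b * A i $$ (b, c) * t ^ (n * c)) = poly (p i) t" for i
    unfolding p_def poly_sum sum.cartesian_product
    by (intro sum.cong) (auto simp: poly_monom power_add)
  ultimately show ?thesis
    by (intro exI[of _ "\<lambda>b. t ^ b"] exI[of _ "\<lambda>c. t ^ (n * c)"]) auto
qed

text \<open>Pairing the row \<open>u A\<close> with the column \<open>B v\<close> gives
  \<open>u (A B) v\<close>; this turns relations between matrices into relations between
  vectors.\<close>

lemma sum_bilinear_mult:
  fixes A B :: "complex mat"
  assumes "A \<in> carrier_mat n n" "B \<in> carrier_mat n n"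
  shows "(\<Sum>a<n. (\<Sum>b<n. u b * A $$ (b, a)) * (\<Sum>c<n. B $$ (a, c) * v c))
    = (\<Sum>b<n. \<Sum>c<n. u b * (A * B) $$ (b, c) * v c)"
proof -
  have "(\<Sum>b<n. \<Sum>c<n. u b * (A * B) $$ (b, c) * v c)
      = (\<Sum>b<n. \<Sum>c<n. \<Sum>a<n. u b * A $$ (b, a) * (B $$ (a, c) * v c))"
    using assms by (intro sum.cong)
      (auto simp: scalar_prod_def atLeast0LessThan sum_distrib_left sum_distrib_right mult.assoc)
  also have "\<dots> = (\<Sum>b<n. \<Sum>a<n. \<Sum>c<n. u b * A $$ (b, a) * (B $$ (a, c) * v c))"
    by (intro sum.cong refl sum.swap)
  also have "\<dots> = (\<Sum>a<n. \<Sum>b<n. \<Sum>c<n. u b * A $$ (b, a) * (B $$ (a, c) * v c))"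
    by (rule sum.swap)
  finally show ?thesis by (simp add: sum_product)
qed

section \<open>Nilpotent families\<close>

text \<open>An arbitrary index set replaces the initial segment, so that subfamilies and families
  cut out of blocks keep their indices during the induction.\<close>

definition anticomm_on :: "nat \<Rightarrow> 'i set \<Rightarrow> ('i \<Rightarrow> complex mat) \<Rightarrow> bool" where
  "anticomm_on n I e \<longleftrightarrow>
     (\<forall>i\<in>I. e i \<in> carrier_mat n n \<and> e i * e i \<noteq> 0\<^sub>m n n) \<and>
     (\<forall>i\<in>I. \<forall>j\<in>I. i \<noteq> j \<longrightarrow> e i * e j = - (e j * e i))"

lemma anticomm_onD:
  assumes "anticomm_on n I e" "i \<in> I"
  shows "e i \<in> carrier_mat n n" "e i * e i \<noteq> 0\<^sub>m n n"
    "j \<in> I \<Longrightarrow> i \<noteq> j \<Longrightarrow> e i * e j = - (e j * e i)"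
  using assms unfolding anticomm_on_def by blast+

lemma anticomm_on_subset: "anticomm_on n I e \<Longrightarrow> J \<subseteq> I \<Longrightarrow> anticomm_on n J e"
  unfolding anticomm_on_def by blast

section \<open>Commutation up to sign\<close>

lemma uminus_zero_mat: "- (0\<^sub>m n m :: 'a :: group_add mat) = 0\<^sub>m n m"
  by (intro eq_matI) auto

text \<open>The sign is left open because it varies with the factors; in this weak form the relation
  survives products and powers, as the greedy product below requires.\<close>

lemma sign_commute_mult:
  fixes A B X :: "complex mat"
  assumes c: "A \<in> carrier_mat n n" "B \<in> carrier_mat n n" "X \<in> carrier_mat n n"
    and A: "A * X = X * A \<or> A * X = - (X * A)" and B: "B * X = X * B \<or> B * X = - (X * B)"
  shows "(A * B) * X = X * (A * B) \<or> (A * B) * X = - (X * (A * B))"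
proof -
  have 1: "(A * B) * X = A * (B * X)" by (rule assoc_mult_mat[OF c])
  have 2: "A * (X * B) = (A * X) * B" by (rule assoc_mult_mat[OF c(1,3,2), symmetric])
  have 3: "X * A * B = X * (A * B)" by (rule assoc_mult_mat[OF c(3,1,2)])
  have 4: "A * - (X * B) = - (A * (X * B))" "- (X * A) * B = - (X * A * B)"
    using c by (simp_all del: assoc_mult_mat)
  show ?thesis using A B unfolding 1 3[symmetric] by (metis 2 4 uminus_uminus_mat)
qed

lemma sign_commute_pow:
  fixes A X :: "complex mat"
  assumes c: "A \<in> carrier_mat n n" "X \<in> carrier_mat n n"
    and A: "A * X = X * A \<or> A * X = - (X * A)"
  shows "(A ^\<^sub>m m) * X = X * (A ^\<^sub>m m) \<or> (A ^\<^sub>m m) * X = - (X * (A ^\<^sub>m m))"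
proof (induction m)
  case 0 then show ?case using c by simp
next
  case (Suc m)
  show ?case unfolding pow_mat.simps
    by (rule sign_commute_mult[OF pow_carrier_mat[OF c(1)] c Suc A])
qed

text \<open>Multiplying greedily by powers of the generators, as long as the product is nonzero, yields
  a nonzero element of the (nilpotent, non-unital) generated algebra annihilated by everything.\<close>

lemma nilpotent_anticomm_socle:
  fixes e :: "'i \<Rightarrow> complex mat"
  assumes fam: "anticomm_on n I e" and I: "finite I" and nil: "\<And>i. i \<in> I \<Longrightarrow> e i ^\<^sub>m N = 0\<^sub>m n n"
    and z: "z \<in> I"
  shows "\<exists>w \<in> carrier_mat n n. w \<noteq> 0\<^sub>m n n \<and> w * w = 0\<^sub>m n n \<and>
    (\<forall>i\<in>I. w * e i = 0\<^sub>m n n \<and> e i * w = 0\<^sub>m n n)"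
proof -
  note car = anticomm_onD(1)[OF fam]
  \<comment> \<open>The product keeps the shape \<open>e z * w'\<close>: its leading factor makes
    \<open>w * w\<close> vanish as soon as \<open>w * e z = 0\<close>.\<close>
  have "finite J \<Longrightarrow> J \<subseteq> I \<Longrightarrow> \<exists>w' \<in> carrier_mat n n. let w = e z * w' in w \<noteq> 0\<^sub>m n n \<and>
    (\<forall>i\<in>I. w * e i = e i * w \<or> w * e i = - (e i * w)) \<and> (\<forall>i\<in>J. w * e i = 0\<^sub>m n n)" for J
  proof (induction J rule: finite_induct)
    case empty
    have "e z \<noteq> 0\<^sub>m n n" using anticomm_onD(2)[OF fam z] by auto
    moreover have "e z * e i = e i * e z \<or> e z * e i = - (e i * e z)" if "i \<in> I" for i
      using anticomm_onD(3)[OF fam z that] by metis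
    ultimately show ?case using car[OF z]
      by (intro bexI[of _ "1\<^sub>m n"]) (simp_all add: Let_def)
  next
    case (insert j J)
    then obtain w' where w': "w' \<in> carrier_mat n n" and w0: "e z * w' \<noteq> 0\<^sub>m n n"
      and wsgn: "\<And>i. i \<in> I \<Longrightarrow> (e z * w') * e i = e i * (e z * w') \<or> (e z * w') * e i = - (e i * (e z * w'))"
      and wz: "\<And>i. i \<in> J \<Longrightarrow> (e z * w') * e i = 0\<^sub>m n n"
      by (auto simp: Let_def)
    define w where "w = e z * w'"
    have w: "w \<in> carrier_mat n n" using car[OF z] w' by (auto simp: w_def)
    have j: "j \<in> I" using insert.prems by auto
    note cj = car[OF j]
    \<comment> \<open>The next greedy product is \<open>w\<close> times the last power of
      \<open>e j\<close> that does not kill it. Earlier annihilation persists, since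
      \<open>e i\<close> moves past powers of \<open>e j\<close> up to sign.\<close>
    define m where "m = (LEAST m. w * e j ^\<^sub>m m = 0\<^sub>m n n)"
    have "w * e j ^\<^sub>m N = 0\<^sub>m n n" using nil[OF j] w by simp
    then have m: "w * e j ^\<^sub>m m = 0\<^sub>m n n" unfolding m_def by (rule LeastI)
    have "m \<noteq> 0"
    proof
      assume "m = 0"
      with m w w0 cj show False by (auto simp: w_def)
    qed
    then obtain a where a: "m = Suc a" by (cases m) auto
    have na: "w * e j ^\<^sub>m a \<noteq> 0\<^sub>m n n"
      using not_less_Least[of a "\<lambda>m. w * e j ^\<^sub>m m = 0\<^sub>m n n"] a unfolding m_def by auto
    let ?p = "e j ^\<^sub>m a"
    have p: "?p \<in> carrier_mat n n" using cj by simp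
    have psgn: "?p * e i = e i * ?p \<or> ?p * e i = - (e i * ?p)" if "i \<in> I" for i
      using sign_commute_pow[OF cj car[OF that]] anticomm_onD(3)[OF fam j that] by metis
    have eq: "e z * (w' * ?p) = w * ?p" using car[OF z] w' p by (simp add: w_def)
    have zz: "(w * ?p) * e i = 0\<^sub>m n n" if i: "i \<in> insert j J" for i
    proof (cases "i = j")
      case True
      then show ?thesis using m a assoc_mult_mat[OF w p cj] by simp
    next
      case False
      then have iJ: "i \<in> J" and iI: "i \<in> I" using i insert.prems by auto
      note ci = car[OF iI]
      have 1: "(w * ?p) * e i = w * (?p * e i)" by (rule assoc_mult_mat[OF w p ci])
      have 2: "w * - (e i * ?p) = - (w * (e i * ?p))" using w p ci by simp
      have "w * (e i * ?p) = (w * e i) * ?p" by (rule assoc_mult_mat[OF w ci p, symmetric])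
      also have "\<dots> = 0\<^sub>m n n" unfolding w_def wz[OF iJ] by (rule left_mult_zero_mat[OF p])
      finally have 3: "w * (e i * ?p) = 0\<^sub>m n n" .
      show ?thesis using psgn[OF iI] unfolding 1 by (metis 2 3 uminus_zero_mat)
    qed
    show ?case
      unfolding Let_def
    proof (intro bexI[of _ "w' * ?p"], unfold eq, intro conjI ballI)
      show "w * ?p * e i = e i * (w * ?p) \<or> w * ?p * e i = - (e i * (w * ?p))" if "i \<in> I" for i
        by (rule sign_commute_mult[OF w p car[OF that] wsgn[OF that, folded w_def] psgn[OF that]])
    qed (insert na zz w' p, blast, blast, simp)
  qed
  from this[OF I subset_refl] obtain w' where w': "w' \<in> carrier_mat n n" and w0: "e z * w' \<noteq> 0\<^sub>m n n"
    and wsgn: "\<And>i. i \<in> I \<Longrightarrow> (e z * w') * e i = e i * (e z * w') \<or> (e z * w') * e i = - (e i * (e z * w'))"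
    and wz: "\<And>i. i \<in> I \<Longrightarrow> (e z * w') * e i = 0\<^sub>m n n"
    by (auto simp: Let_def)
  define w where "w = e z * w'"
  have w: "w \<in> carrier_mat n n" using car[OF z] w' by (auto simp: w_def)
  have "w * w = (w * e z) * w'"
    using assoc_mult_mat[OF w car[OF z] w'] by (simp add: w_def)
  also have "\<dots> = 0\<^sub>m n n" using wz[OF z] w' by (simp add: w_def)
  finally have "w * w = 0\<^sub>m n n" .
  moreover have "e i * w = 0\<^sub>m n n" if "i \<in> I" for i
  proof -
    have c: "e i * w \<in> carrier_mat n n" using car[OF that] w by auto
    from wsgn[OF that] wz[OF that] have "e i * w = 0\<^sub>m n n \<or> - (e i * w) = 0\<^sub>m n n"
      unfolding w_def by metis
    then show ?thesis using c by (metis uminus_uminus_mat uminus_zero_mat)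
  qed
  ultimately show ?thesis using w w0 wz by (intro bexI[of _ w]) (auto simp: w_def)
qed

text \<open>Let \<open>w\<close> be as above with \<open>w\<^sub>p\<^sub>q \<noteq> 0\<close>, let \<open>x\<close> be its \<open>q\<close>-th column and \<open>z\<close> its \<open>p\<close>-th row.
  For generic \<open>u\<close>, \<open>v\<close> the vectors \<open>(u e\<^sub>i, e\<^sub>i v)\<close> are orthogonal and non-isotropic for the
  hyperbolic form on \<open>\<complex>\<^sup>2\<^sup>n\<close>, and they are orthogonal to the totally isotropic plane spanned by
  \<open>(0, x)\<close> and \<open>(z, 0)\<close>. Adding this plane and a dual one gives \<open>card I + 4\<close> independent vectors.\<close>

lemma nilpotent_anticomm_card:
  fixes e :: "'i \<Rightarrow> complex mat"
  assumes fam: "anticomm_on n I e" and I: "finite I" "I \<noteq> {}"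
    and nil: "\<And>i. i \<in> I \<Longrightarrow> e i ^\<^sub>m N = 0\<^sub>m n n"
  shows "card I + 4 \<le> 2 * n"
proof (rule ccontr)
  assume less: "\<not> ?thesis"
  note car = anticomm_onD(1)[OF fam]
  from I(2) obtain i0 where "i0 \<in> I" by auto
  from nilpotent_anticomm_socle[OF fam I(1) nil this] obtain w
    where w: "w \<in> carrier_mat n n" "w \<noteq> 0\<^sub>m n n" "w * w = 0\<^sub>m n n"
      and we: "\<And>i. i \<in> I \<Longrightarrow> w * e i = 0\<^sub>m n n" "\<And>i. i \<in> I \<Longrightarrow> e i * w = 0\<^sub>m n n" by auto
  from nonzero_mat_entry[OF w(1,2)] obtain p q where pq: "p < n" "q < n" "w $$ (p, q) \<noteq> 0" by auto
  define x where "x = (\<lambda>t. w $$ (t, q))"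
  define z where "z = (\<lambda>t. w $$ (p, t))"
  have xz0: "x p \<noteq> 0" "z q \<noteq> 0" using pq by (auto simp: x_def z_def)
  have entry: "(A * B) $$ (a, b) = (\<Sum>t<n. A $$ (a, t) * B $$ (t, b))"
    if "A \<in> carrier_mat n n" "B \<in> carrier_mat n n" "a < n" "b < n" for A B :: "complex mat" and a b
    using that by (auto simp: scalar_prod_def atLeast0LessThan)
  \<comment> \<open>This is entry \<open>(p, q)\<close> of \<open>w * w = 0\<close>; it makes the
    plane spanned by \<open>(0, x)\<close> and \<open>(z, 0)\<close> totally isotropic.\<close>
  have zx: "(\<Sum>t<n. z t * x t) = 0"
    using entry[OF w(1,1) pq(1,2)] pq unfolding w(3) by (simp add: x_def z_def)
  have "\<exists>u v. \<forall>i\<in>I. (\<Sum>b<n. \<Sum>c<n. u b * (e i * e i) $$ (b, c) * v c) \<noteq> 0"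
    by (rule generic_bilinear_nonzero[OF I(1)]) (use car anticomm_onD(2)[OF fam] in \<open>blast intro: mult_carrier_mat\<close>)
  then obtain u v where uv: "\<And>i. i \<in> I \<Longrightarrow> (\<Sum>b<n. \<Sum>c<n. u b * (e i * e i) $$ (b, c) * v c) \<noteq> 0"
    by blast
  define \<alpha> where "\<alpha> = (\<lambda>i t. \<Sum>b<n. u b * e i $$ (b, t))"
  define \<beta> where "\<beta> = (\<lambda>i t. \<Sum>c<n. e i $$ (t, c) * v c)"
  have \<alpha>x: "(\<Sum>t<n. \<alpha> i t * x t) = 0" if i: "i \<in> I" for i
  proof -
    have "(\<Sum>t<n. \<alpha> i t * x t) = (\<Sum>b<n. \<Sum>t<n. u b * (e i $$ (b, t) * w $$ (t, q)))"
      unfolding \<alpha>_def x_def sum_distrib_right by (subst sum.swap) (simp add: mult.assoc)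
    also have "\<dots> = (\<Sum>b<n. u b * (e i * w) $$ (b, q))"
      by (intro sum.cong refl) (simp add: entry[OF car[OF i] w(1)] pq sum_distrib_left)
    finally show ?thesis unfolding we(2)[OF i] using pq by simp
  qed
  have z\<beta>: "(\<Sum>t<n. z t * \<beta> i t) = 0" if i: "i \<in> I" for i
  proof -
    have "(\<Sum>t<n. z t * \<beta> i t) = (\<Sum>c<n. \<Sum>t<n. w $$ (p, t) * e i $$ (t, c) * v c)"
      unfolding \<beta>_def z_def sum_distrib_left by (subst sum.swap) (simp add: mult.assoc)
    also have "\<dots> = (\<Sum>c<n. (w * e i) $$ (p, c) * v c)"
      by (intro sum.cong refl) (simp add: entry[OF w(1) car[OF i]] pq sum_distrib_right)
    finally show ?thesis unfolding we(1)[OF i] using pq by simp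
  qed
  have \<alpha>\<beta>: "(\<Sum>t<n. \<alpha> i t * \<beta> j t) = (\<Sum>b<n. \<Sum>c<n. u b * (e i * e j) $$ (b, c) * v c)"
    if "i \<in> I" "j \<in> I" for i j
    unfolding \<alpha>_def \<beta>_def by (rule sum_bilinear_mult[OF car[OF that(1)] car[OF that(2)]])
  \<comment> \<open>The relation \<open>e i * e j + e j * e i = 0\<close>, evaluated at
    \<open>u\<close> and \<open>v\<close>. For equal indices the pairing is twice
    \<open>u (e i * e i) v\<close>, nonzero by the choice of \<open>u\<close> and
    \<open>v\<close>.\<close>
  have orth: "(\<Sum>t<n. \<alpha> i t * \<beta> j t) + (\<Sum>t<n. \<alpha> j t * \<beta> i t) = 0"
    if ij: "i \<in> I" "j \<in> I" "i \<noteq> j" for i j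
  proof -
    have "(e i * e j) $$ (b, c) = - ((e j * e i) $$ (b, c))" if "b < n" "c < n" for b c
      using that car[OF ij(1)] car[OF ij(2)] by (subst anticomm_onD(3)[OF fam ij]) simp
    then have "(\<Sum>b<n. \<Sum>c<n. u b * (e i * e j) $$ (b, c) * v c)
        = (\<Sum>b<n. \<Sum>c<n. - (u b * (e j * e i) $$ (b, c) * v c))"
      by (intro sum.cong refl) simp
    then show ?thesis unfolding \<alpha>\<beta>[OF ij(1,2)] \<alpha>\<beta>[OF ij(2,1)] by (simp add: sum_negf)
  qed
  \<comment> \<open>\<open>Inl i\<close> stands for the vector of \<open>e i\<close>, and
    \<open>Inr 0\<close>, \<open>Inr 1\<close> for \<open>(0, x)\<close>, \<open>(z, 0)\<close>.
    \<open>Inr 2\<close> is the \<open>p\<close>-th unit vector of the first half and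
    \<open>Inr 3\<close> the \<open>q\<close>-th of the second; they detect the plane because
    \<open>x p\<close> and \<open>z q\<close> are nonzero. \<open>J\<close> lists the
    \<open>2 * n\<close> coordinates.\<close>
  define K where "K = I <+> {0, 1, 2, 3 :: nat}"
  define J where "J = {..<n} <+> {..<n}"
  define f where "f = (\<lambda>k j. case j of
      Inl t \<Rightarrow> case_sum (\<lambda>i. \<alpha> i t) (\<lambda>m :: nat. if m = 1 then z t else if m = 2 \<and> t = p then 1 else 0) k
    | Inr t \<Rightarrow> case_sum (\<lambda>i. \<beta> i t) (\<lambda>m :: nat. if m = 0 then x t else if m = 3 \<and> t = q then 1 else 0) k)"
  have fin: "finite J" "finite K" using I(1) by (auto simp: J_def K_def)
  have "card J < card K" using less I(1) by (simp add: J_def K_def card_Plus)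
  from homogeneous_system_nontrivial_solution[OF fin this, of f] obtain c where
    c0: "\<exists>k\<in>K. c k \<noteq> 0" and c: "\<And>j. j \<in> J \<Longrightarrow> (\<Sum>k\<in>K. c k * f k j) = 0" by blast
  define d where "d = (\<lambda>i. c (Inl i))"
  define s where "s = (\<lambda>m. c (Inr m))"
  have inJ: "Inl t \<in> J" "Inr t \<in> J" if "t < n" for t
    using that by (auto simp: J_def)
  have eqA: "(\<Sum>i\<in>I. d i * \<alpha> i t) + s 1 * z t + (if t = p then s 2 else 0) = 0" if "t < n" for t
    using c[OF inJ(1)[OF that]] I(1) unfolding K_def d_def s_def f_def
    by (auto simp: sum.Plus add.assoc split: if_splits)
  have eqB: "(\<Sum>i\<in>I. d i * \<beta> i t) + s 0 * x t + (if t = q then s 3 else 0) = 0" if "t < n" for t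
    using c[OF inJ(2)[OF that]] I(1) unfolding K_def d_def s_def f_def
    by (auto simp: sum.Plus add.assoc split: if_splits)
  \<comment> \<open>\<open>pairA\<close> and \<open>pairB\<close> pair the dependence relation with
    \<open>(0, y)\<close> and \<open>(y, 0)\<close>.\<close>
  have pairA: "(\<Sum>i\<in>I. d i * (\<Sum>t<n. \<alpha> i t * y t)) + s 1 * (\<Sum>t<n. z t * y t) + s 2 * y p = 0" for y
  proof -
    have "0 = (\<Sum>t<n. ((\<Sum>i\<in>I. d i * \<alpha> i t) + s 1 * z t + (if t = p then s 2 else 0)) * y t)"
      using eqA by simp
    also have "\<dots> = (\<Sum>t<n. (\<Sum>i\<in>I. d i * (\<alpha> i t * y t)) + s 1 * (z t * y t) + (if t = p then s 2 * y t else 0))"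
      by (intro sum.cong refl) (simp add: algebra_simps sum_distrib_left)
    also have "\<dots> = (\<Sum>t<n. \<Sum>i\<in>I. d i * (\<alpha> i t * y t)) + s 1 * (\<Sum>t<n. z t * y t)
        + (\<Sum>t<n. if t = p then s 2 * y t else 0)"
      by (simp add: sum.distrib sum_distrib_left)
    also have "(\<Sum>t<n. \<Sum>i\<in>I. d i * (\<alpha> i t * y t)) = (\<Sum>i\<in>I. d i * (\<Sum>t<n. \<alpha> i t * y t))"
      by (subst sum.swap) (simp add: sum_distrib_left)
    finally show ?thesis using pq by (simp add: sum.delta')
  qed
  have pairB: "(\<Sum>i\<in>I. d i * (\<Sum>t<n. y t * \<beta> i t)) + s 0 * (\<Sum>t<n. y t * x t) + s 3 * y q = 0" for y
  proof -
    have "0 = (\<Sum>t<n. ((\<Sum>i\<in>I. d i * \<beta> i t) + s 0 * x t + (if t = q then s 3 else 0)) * y t)"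
      using eqB by simp
    also have "\<dots> = (\<Sum>t<n. (\<Sum>i\<in>I. d i * (y t * \<beta> i t)) + s 0 * (y t * x t) + (if t = q then s 3 * y t else 0))"
      by (intro sum.cong refl) (simp add: algebra_simps sum_distrib_left)
    also have "\<dots> = (\<Sum>t<n. \<Sum>i\<in>I. d i * (y t * \<beta> i t)) + s 0 * (\<Sum>t<n. y t * x t)
        + (\<Sum>t<n. if t = q then s 3 * y t else 0)"
      by (simp add: sum.distrib sum_distrib_left)
    also have "(\<Sum>t<n. \<Sum>i\<in>I. d i * (y t * \<beta> i t)) = (\<Sum>i\<in>I. d i * (\<Sum>t<n. y t * \<beta> i t))"
      by (subst sum.swap) (simp add: sum_distrib_left)
    finally show ?thesis using pq by (simp add: sum.delta')
  qed
  \<comment> \<open>Pairing with \<open>(0, x)\<close> annihilates everything but the dual vector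
    and leaves \<open>s 2 * x p = 0\<close>; pairing with \<open>(z, 0)\<close> leaves
    \<open>s 3 * z q = 0\<close>.\<close>
  have s2: "s 2 = 0" using pairA[of x] \<alpha>x zx xz0 by simp
  have s3: "s 3 = 0" using pairB[of z] z\<beta> zx xz0 by simp
  have d0: "d j = 0" if j: "j \<in> I" for j
  proof -
    \<comment> \<open>Pairing with the vector of index \<open>j\<close>: the isotropic plane drops
      out, and orthogonality then removes all terms with \<open>i\<close> different from
      \<open>j\<close>.\<close>
    have "(\<Sum>i\<in>I. d i * ((\<Sum>t<n. \<alpha> i t * \<beta> j t) + (\<Sum>t<n. \<alpha> j t * \<beta> i t))) = 0"
      using pairA[of "\<beta> j"] pairB[of "\<alpha> j"] z\<beta>[OF j] \<alpha>x[OF j] s2 s3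
      by (simp add: distrib_left sum.distrib)
    moreover have "(\<Sum>i\<in>I. d i * ((\<Sum>t<n. \<alpha> i t * \<beta> j t) + (\<Sum>t<n. \<alpha> j t * \<beta> i t)))
        = (\<Sum>i\<in>I. if i = j then 2 * d j * (\<Sum>t<n. \<alpha> j t * \<beta> j t) else 0)"
      by (intro sum.cong refl) (use orth j in auto)
    ultimately have "d j * (\<Sum>t<n. \<alpha> j t * \<beta> j t) = 0" using I(1) j by simp
    then show ?thesis using uv[OF j] unfolding \<alpha>\<beta>[OF j j] by simp
  qed
  have "s 1 = 0" using eqA[OF pq(2)] d0 s2 xz0 by (simp split: if_splits)
  moreover have "s 0 = 0" using eqB[OF pq(1)] d0 s3 xz0 by (simp split: if_splits)
  ultimately have "\<forall>k\<in>K. c k = 0" using d0 s2 s3 by (auto simp: K_def d_def s_def)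
  then show False using c0 by blast
qed

section \<open>Fitting decomposition and commutants\<close>

lemma nonzero_det_inverse:
  fixes A :: "'a :: field mat"
  assumes A: "A \<in> carrier_mat n n" and d: "det A \<noteq> 0"
  obtains B where "B \<in> carrier_mat n n" "A * B = 1\<^sub>m n" "B * A = 1\<^sub>m n"
  using det_non_zero_imp_unit[OF A d, of "()"]
  by (auto simp: Units_def ring_mat_def)

lemma det_pow_mat:
  fixes A :: "'a :: comm_ring_1 mat"
  assumes A: "A \<in> carrier_mat n n"
  shows "det (A ^\<^sub>m k) = det A ^ k"
proof (induction k)
  case (Suc k)
  have "det (A ^\<^sub>m k * A) = det (A ^\<^sub>m k) * det A" by (rule det_mult[OF pow_carrier_mat[OF A] A])
  then show ?case using Suc by simp
qed (use A in simp)

text \<open>Every factor pushes the support at least one diagonal further up, so the power vanishes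
  once the exponent reaches the size.\<close>

lemma strictly_upper_triangular_pow:
  fixes U :: "'a :: semiring_1 mat"
  assumes U: "U \<in> carrier_mat r r" and z: "\<And>i j. i < r \<Longrightarrow> j \<le> i \<Longrightarrow> U $$ (i, j) = 0"
  shows "i < r \<Longrightarrow> j < r \<Longrightarrow> j < i + m \<Longrightarrow> (U ^\<^sub>m m) $$ (i, j) = 0"
proof (induction m arbitrary: j)
  case 0 then show ?case using U by auto
next
  case (Suc m)
  have "(U ^\<^sub>m m) $$ (i, l) * U $$ (l, j) = 0" if "l < r" for l
  proof (cases "l < i + m")
    case True then show ?thesis using Suc that by simp
  next
    case False then show ?thesis using z[OF that, of j] Suc.prems by simp
  qed
  then show ?case using U Suc.prems pow_carrier_mat[OF U, of m] by (simp add: scalar_prod_def)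
qed

lemma four_block_mat_inject:
  assumes "A \<in> carrier_mat r1 c1" "A' \<in> carrier_mat r1 c1" "B \<in> carrier_mat r1 c2" "B' \<in> carrier_mat r1 c2"
    "C \<in> carrier_mat r2 c1" "C' \<in> carrier_mat r2 c1" "D \<in> carrier_mat r2 c2" "D' \<in> carrier_mat r2 c2"
    and eq: "four_block_mat A B C D = four_block_mat A' B' C' D'"
  shows "A = A'" "B = B'" "C = C'" "D = D'"
proof -
  have ent: "four_block_mat A B C D $$ (i, j) = four_block_mat A' B' C' D' $$ (i, j)" for i j
    using eq by simp
  show "A = A'"
  proof (intro eq_matI)
    fix i j assume "i < dim_row A'" "j < dim_col A'"
    then show "A $$ (i, j) = A' $$ (i, j)" using ent[of i j] assms(1-8) by auto
  qed (use assms in auto)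
  show "B = B'"
  proof (intro eq_matI)
    fix i j assume "i < dim_row B'" "j < dim_col B'"
    then show "B $$ (i, j) = B' $$ (i, j)" using ent[of i "j + c1"] assms(1-8) by auto
  qed (use assms in auto)
  show "C = C'"
  proof (intro eq_matI)
    fix i j assume "i < dim_row C'" "j < dim_col C'"
    then show "C $$ (i, j) = C' $$ (i, j)" using ent[of "i + r1" j] assms(1-8) by auto
  qed (use assms in auto)
  show "D = D'"
  proof (intro eq_matI)
    fix i j assume "i < dim_row D'" "j < dim_col D'"
    then show "D $$ (i, j) = D' $$ (i, j)" using ent[of "i + r1" "j + c1"] assms(1-8) by auto
  qed (use assms in auto)
qed

lemma prod_list_partition:
  fixes f :: "'b \<Rightarrow> 'a :: comm_monoid_mult"
  shows "(\<Prod>a\<leftarrow>filter P as @ filter (\<lambda>a. \<not> P a) as. f a) = (\<Prod>a\<leftarrow>as. f a)"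
  by (induction as) (auto simp: ac_simps)

text \<open>The corner \<open>C'\<close> may stay unspecified, because a shear removes it in the
  Fitting decomposition.\<close>

lemma upper_block_pow:
  fixes U :: "'a :: semiring_1 mat"
  assumes U: "U \<in> carrier_mat r r" and C: "C \<in> carrier_mat r s" and D: "D \<in> carrier_mat s s"
  shows "\<exists>C'\<in>carrier_mat r s.
    four_block_mat U C (0\<^sub>m s r) D ^\<^sub>m m = four_block_mat (U ^\<^sub>m m) C' (0\<^sub>m s r) (D ^\<^sub>m m)"
proof (induction m)
  case 0 then show ?case using U D by (intro bexI[of _ "0\<^sub>m r s"]) auto
next
  case (Suc m)
  then obtain C' where C': "C' \<in> carrier_mat r s"
    and eq: "four_block_mat U C (0\<^sub>m s r) D ^\<^sub>m m = four_block_mat (U ^\<^sub>m m) C' (0\<^sub>m s r) (D ^\<^sub>m m)" by blast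
  note Um = pow_carrier_mat[OF U, of m] and Dm = pow_carrier_mat[OF D, of m]
  show ?case
    unfolding pow_mat.simps eq
    by (subst mult_four_block_mat[OF Um C' zero_carrier_mat Dm U C zero_carrier_mat D],
        intro bexI[of _ "U ^\<^sub>m m * C + C' * D"] cong_four_block_mat)
      (use Um Dm U C D C' in auto)
qed

text \<open>A Schur form with the zero eigenvalues first makes the \<open>n\<close>-th power block
  upper triangular, with a zero block from the strictly triangular part and an invertible block
  \<open>W\<close>; a shear then clears the corner.\<close>

lemma fitting_decomposition:
  fixes M :: "complex mat"
  assumes M: "M \<in> carrier_mat n n"
  obtains r s S T W where "n = r + s" "S \<in> carrier_mat n n" "T \<in> carrier_mat n n"
    "S * T = 1\<^sub>m n" "T * S = 1\<^sub>m n" "W \<in> carrier_mat s s" "det W \<noteq> 0"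
    "T * (M ^\<^sub>m n) * S = four_block_mat (0\<^sub>m r r) (0\<^sub>m r s) (0\<^sub>m s r) W"
proof -
  from char_poly_factorized[OF M] obtain as where as: "char_poly M = (\<Prod>a\<leftarrow>as. [:- a, 1:])" by auto
  \<comment> \<open>Listing the zeros first puts the nilpotent part into the upper left block;
    \<open>r\<close> below is the algebraic multiplicity of the eigenvalue 0.\<close>
  define es where "es = filter (\<lambda>a. a = 0) as @ filter (\<lambda>a. a \<noteq> 0) as"
  have "(\<Prod>a\<leftarrow>es. [:- a, 1:]) = (\<Prod>a\<leftarrow>as. [:- a, 1:])"
    unfolding es_def by (rule prod_list_partition)
  with as have es: "char_poly M = (\<Prod>a\<leftarrow>es. [:- a, 1:])" by simp
  obtain B P Q where "schur_decomposition M es = (B, P, Q)" by (cases "schur_decomposition M es")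
  from schur_decomposition[OF M es this]
  have wit: "similar_mat_wit M B P Q" and ut: "upper_triangular B" and dg: "diag_mat B = es" by auto
  note BPQ = similar_mat_witD2[OF M wit]
  note B = BPQ(5) and P = BPQ(6) and Q = BPQ(7)
  define r where "r = length (filter (\<lambda>a. a = 0) as)"
  define s where "s = n - r"
  have len: "length es = n" unfolding dg[symmetric] using B by (simp add: diag_mat_def)
  then have n: "n = r + s" by (simp add: s_def r_def es_def)
  have diag: "B $$ (i, i) = es ! i" if "i < n" for i
    unfolding dg[symmetric] using B that by (simp add: diag_mat_def)
  obtain U C L D where "split_block B r r = (U, C, L, D)" by (cases "split_block B r r") auto
  from split_block[OF this, of s s] B n
  have U: "U \<in> carrier_mat r r" and C: "C \<in> carrier_mat r s" and L: "L \<in> carrier_mat s r"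
    and D: "D \<in> carrier_mat s s" and Beq: "B = four_block_mat U C L D" by auto
  have utB: "B $$ (i, j) = 0" if "j < i" "i < n" for i j
    using ut that B unfolding upper_triangular_def by auto
  have L0: "L = 0\<^sub>m s r"
  proof (intro eq_matI)
    fix i j assume "i < dim_row (0\<^sub>m s r)" "j < dim_col (0\<^sub>m s r)"
    then show "L $$ (i, j) = 0\<^sub>m s r $$ (i, j)"
      using utB[of j "i + r"] n U D unfolding Beq by auto
  qed (use L in auto)
  have Ustrict: "U $$ (i, j) = 0" if ij: "i < r" "j \<le> i" for i j
  proof (cases "j = i")
    case True
    have "es ! i = filter (\<lambda>a. a = 0) as ! i" using ij by (simp add: es_def r_def nth_append)
    also have "\<dots> = 0" using nth_mem[of i "filter (\<lambda>a. a = 0) as"] ij by (auto simp: r_def)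
    finally show ?thesis using diag[of i] True ij n U D unfolding Beq by auto
  next
    case False
    then show ?thesis using utB[of j i] ij n U D unfolding Beq by auto
  qed
  have utD: "upper_triangular D"
  proof (rule upper_triangularI)
    fix i j assume "j < i" "i < dim_row D"
    then show "D $$ (i, j) = 0" using utB[of "j + r" "i + r"] n U D unfolding Beq by auto
  qed
  have "D $$ (i, i) \<noteq> 0" if i: "i < s" for i
  proof -
    have "es ! (i + r) = filter (\<lambda>a. a \<noteq> 0) as ! i" by (simp add: es_def r_def nth_append)
    moreover have "i < length (filter (\<lambda>a. a \<noteq> 0) as)" using len i n by (simp add: es_def r_def)
    ultimately have "es ! (i + r) \<noteq> 0" using nth_mem by fastforce
    then show ?thesis using diag[of "i + r"] i n U D unfolding Beq by auto
  qed
  then have detD: "det D \<noteq> 0"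
    unfolding det_upper_triangular[OF utD D] using D by (auto simp: diag_mat_def prod_list_zero_iff)
  define W where "W = D ^\<^sub>m n"
  have W: "W \<in> carrier_mat s s" and detW: "det W \<noteq> 0"
    using D detD by (auto simp: W_def det_pow_mat[OF D])
  from upper_block_pow[OF U C D, of n] obtain C' where C': "C' \<in> carrier_mat r s"
    and "B ^\<^sub>m n = four_block_mat (U ^\<^sub>m n) C' (0\<^sub>m s r) W" unfolding Beq L0 W_def by blast
  moreover have "U ^\<^sub>m n = 0\<^sub>m r r"
    using strictly_upper_triangular_pow[OF U Ustrict, of _ _ n] n U by (intro eq_matI) auto
  ultimately have Bn: "B ^\<^sub>m n = four_block_mat (0\<^sub>m r r) C' (0\<^sub>m s r) W" by simp
  obtain V where V: "V \<in> carrier_mat s s" "W * V = 1\<^sub>m s" "V * W = 1\<^sub>m s"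
    using nonzero_det_inverse[OF W detW] .
  \<comment> \<open>\<open>X\<close> solves \<open>X * W = C'\<close>, so conjugation by the shear
    \<open>S'\<close> with inverse \<open>T'\<close> replaces the corner by
    \<open>C' - X * W = 0\<close>.\<close>
  define X where "X = C' * V"
  have X: "X \<in> carrier_mat r s" using C' V by (simp add: X_def)
  define S' where "S' = four_block_mat (1\<^sub>m r) X (0\<^sub>m s r) (1\<^sub>m s)"
  define T' where "T' = four_block_mat (1\<^sub>m r) (- X) (0\<^sub>m s r) (1\<^sub>m s)"
  have S': "S' \<in> carrier_mat n n" and T': "T' \<in> carrier_mat n n" by (auto simp: S'_def T'_def n)
  have uX: "- X \<in> carrier_mat r s" using X by simp
  have uXX: "- X + X = 0\<^sub>m r s" "C' + - C' = 0\<^sub>m r s" using X C' by (auto intro!: eq_matI)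
  have ST': "S' * T' = 1\<^sub>m n"
    unfolding S'_def T'_def n four_block_one_mat[symmetric]
    by (subst mult_four_block_mat[OF one_carrier_mat X zero_carrier_mat one_carrier_mat
          one_carrier_mat uX zero_carrier_mat one_carrier_mat], intro cong_four_block_mat)
      (use X uXX in \<open>simp_all add: uminus_zero_mat\<close>)
  then have TS': "T' * S' = 1\<^sub>m n" by (rule mat_mult_left_right_inverse[OF S' T'])
  have XW: "X * W = C'" using assoc_mult_mat[OF C' V(1) W] V(3) C' by (simp add: X_def)
  have "B ^\<^sub>m n * S' = four_block_mat (0\<^sub>m r r) C' (0\<^sub>m s r) W"
    unfolding Bn S'_def
    by (subst mult_four_block_mat[OF zero_carrier_mat C' zero_carrier_mat W
          one_carrier_mat X zero_carrier_mat one_carrier_mat], intro cong_four_block_mat)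
      (use X W C' in simp_all)
  moreover have "T' * four_block_mat (0\<^sub>m r r) C' (0\<^sub>m s r) W
      = four_block_mat (0\<^sub>m r r) (0\<^sub>m r s) (0\<^sub>m s r) W"
    unfolding T'_def
    by (subst mult_four_block_mat[OF one_carrier_mat uX zero_carrier_mat one_carrier_mat
          zero_carrier_mat C' zero_carrier_mat W], intro cong_four_block_mat)
      (use X W C' XW uXX in \<open>simp_all add: uminus_zero_mat\<close>)
  ultimately have fin: "T' * (B ^\<^sub>m n * S') = four_block_mat (0\<^sub>m r r) (0\<^sub>m r s) (0\<^sub>m s r) W" by simp
  have Mn: "M ^\<^sub>m n = P * B ^\<^sub>m n * Q"
    by (rule similar_mat_wit_pow_id[OF wit])
  define S where "S = P * S'"
  define T where "T = T' * Q"
  have B': "B ^\<^sub>m n \<in> carrier_mat n n" using B by simp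
  note as = assoc_mult_mat[of _ n n _ n _ n]
  have S: "S \<in> carrier_mat n n" and T: "T \<in> carrier_mat n n" using P Q S' T' by (auto simp: S_def T_def)
  have QP: "Q * (P * Y) = Y" if "Y \<in> carrier_mat n n" for Y
    using as[OF Q P that] BPQ(2) that by simp
  have "T * S = T' * (Q * (P * S'))"
    unfolding S_def T_def using P Q S' T' by (simp add: as)
  also have "\<dots> = 1\<^sub>m n" using QP[OF S'] TS' by simp
  finally have TS: "T * S = 1\<^sub>m n" .
  then have ST: "S * T = 1\<^sub>m n" by (rule mat_mult_left_right_inverse[OF T S])
  have "T * (M ^\<^sub>m n) * S = T' * (Q * (P * (B ^\<^sub>m n * (Q * (P * S')))))"
    unfolding S_def T_def Mn using P Q S' T' B' by (simp add: as)
  also have "\<dots> = T' * (B ^\<^sub>m n * S')" using QP[OF S'] QP[of "B ^\<^sub>m n * S'"] B' S' by simp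
  finally show ?thesis using that[OF n S T ST TS W detW] fin by simp
qed

section \<open>Commuting matrices, conjugation and block diagonal form\<close>

lemma commute_pow_mat:
  fixes X :: "'a :: semiring_1 mat"
  assumes X: "X \<in> carrier_mat n n" and M: "M \<in> carrier_mat n n" and c: "X * M = M * X"
  shows "X * M ^\<^sub>m k = M ^\<^sub>m k * X"
proof (induction k)
  case 0 then show ?case using X M by simp
next
  case (Suc k)
  note Mk = pow_carrier_mat[OF M, of k]
  have "X * (M ^\<^sub>m k * M) = (X * M ^\<^sub>m k) * M" by (rule assoc_mult_mat[OF X Mk M, symmetric])
  also have "\<dots> = M ^\<^sub>m k * (X * M)" unfolding Suc by (rule assoc_mult_mat[OF Mk X M])
  also have "\<dots> = M ^\<^sub>m k * M * X" unfolding c by (rule assoc_mult_mat[OF Mk M X, symmetric])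
  finally show ?case by simp
qed

lemma pow_mat_mult_commute:
  fixes A :: "'a :: semiring_1 mat"
  assumes A: "A \<in> carrier_mat n n" and B: "B \<in> carrier_mat n n" and c: "A * B = B * A"
  shows "(A * B) ^\<^sub>m k = A ^\<^sub>m k * B ^\<^sub>m k"
proof (induction k)
  case 0 then show ?case using A B by simp
next
  case (Suc k)
  note Ak = pow_carrier_mat[OF A, of k] and Bk = pow_carrier_mat[OF B, of k]
  have "A ^\<^sub>m k * B ^\<^sub>m k * (A * B) = A ^\<^sub>m k * ((B ^\<^sub>m k * A) * B)"
    using A B Ak Bk by (simp add: assoc_mult_mat[of _ n n _ n _ n])
  also have "B ^\<^sub>m k * A = A * B ^\<^sub>m k" by (rule commute_pow_mat[OF A B c, symmetric])
  also have "A ^\<^sub>m k * (A * B ^\<^sub>m k * B) = A ^\<^sub>m k * A * (B ^\<^sub>m k * B)"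
    using A B Ak Bk assoc_mult_mat[OF Ak A mult_carrier_mat[OF Bk B]] by (simp add: assoc_mult_mat[of _ n n _ n _ n])
  finally show ?case using Suc by simp
qed

lemma conj_mult_mat:
  fixes X :: "'a :: semiring_1 mat"
  assumes "S \<in> carrier_mat n n" "T \<in> carrier_mat n n" "X \<in> carrier_mat n n" "Y \<in> carrier_mat n n"
    and ST: "S * T = 1\<^sub>m n"
  shows "T * (X * Y) * S = (T * X * S) * (T * Y * S)"
proof -
  have "(T * X * S) * (T * Y * S) = T * (X * ((S * T) * (Y * S)))"
    using assms(1-4) by (simp add: assoc_mult_mat[of _ n n _ n _ n])
  then show ?thesis
    unfolding ST using assms(1-4) by (simp add: assoc_mult_mat[of _ n n _ n _ n])
qed

lemma conj_eq_zero_iff: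
  fixes X :: "'a :: semiring_1 mat"
  assumes "S \<in> carrier_mat n n" "T \<in> carrier_mat n n" "X \<in> carrier_mat n n" and ST: "S * T = 1\<^sub>m n"
  shows "T * X * S = 0\<^sub>m n n \<longleftrightarrow> X = 0\<^sub>m n n"
proof
  assume 0: "T * X * S = 0\<^sub>m n n"
  have "X = (S * T) * X * (S * T)" using assms by simp
  also have "\<dots> = S * (T * X * S) * T"
    using assms(1-3) by (simp add: assoc_mult_mat[of _ n n _ n _ n] del: ST)
  also have "\<dots> = 0\<^sub>m n n" unfolding 0 using assms by simp
  finally show "X = 0\<^sub>m n n" .
qed (use assms in simp)

lemma mult_block_diag_mat:
  fixes a :: "'a :: semiring_1 mat"
  assumes "a \<in> carrier_mat r r" "d \<in> carrier_mat s s" "a' \<in> carrier_mat r r" "d' \<in> carrier_mat s s"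
  shows "four_block_mat a (0\<^sub>m r s) (0\<^sub>m s r) d * four_block_mat a' (0\<^sub>m r s) (0\<^sub>m s r) d'
    = four_block_mat (a * a') (0\<^sub>m r s) (0\<^sub>m s r) (d * d')"
  by (subst mult_four_block_mat[OF assms(1) zero_carrier_mat zero_carrier_mat assms(2)
        assms(3) zero_carrier_mat zero_carrier_mat assms(4)], intro cong_four_block_mat)
    (use assms in simp_all)

lemma uminus_block_diag_mat:
  fixes a :: "'a :: group_add mat"
  assumes "a \<in> carrier_mat r r" "d \<in> carrier_mat s s"
  shows "- four_block_mat a (0\<^sub>m r s) (0\<^sub>m s r) d = four_block_mat (- a) (0\<^sub>m r s) (0\<^sub>m s r) (- d)"
  using assms by (intro eq_matI) auto

lemma block_diag_eq_zero_iff: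
  assumes "a \<in> carrier_mat r r" "d \<in> carrier_mat s s"
  shows "four_block_mat a (0\<^sub>m r s) (0\<^sub>m s r) d = 0\<^sub>m (r + s) (r + s) \<longleftrightarrow> a = 0\<^sub>m r r \<and> d = 0\<^sub>m s s"
proof
  assume "four_block_mat a (0\<^sub>m r s) (0\<^sub>m s r) d = 0\<^sub>m (r + s) (r + s)"
  then have eq: "four_block_mat a (0\<^sub>m r s) (0\<^sub>m s r) d
    = four_block_mat (0\<^sub>m r r) (0\<^sub>m r s) (0\<^sub>m s r) (0\<^sub>m s s)" by simp
  note inj = four_block_mat_inject[OF assms(1) zero_carrier_mat zero_carrier_mat zero_carrier_mat
    zero_carrier_mat zero_carrier_mat assms(2) zero_carrier_mat eq]
  show "a = 0\<^sub>m r r \<and> d = 0\<^sub>m s s" using inj(1,4) by blast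
qed simp

lemma right_cancel_mat:
  fixes W :: "'a :: field mat"
  assumes "b \<in> carrier_mat m s" "W \<in> carrier_mat s s" "det W \<noteq> 0" "b * W = 0\<^sub>m m s"
  shows "b = 0\<^sub>m m s"
proof -
  obtain V where V: "V \<in> carrier_mat s s" "W * V = 1\<^sub>m s"
    using nonzero_det_inverse[OF assms(2,3)] by blast
  have "b * W * V = b" using assoc_mult_mat[OF assms(1,2) V(1)] V(2) assms(1) by simp
  then show ?thesis using assms(4) V(1) by simp
qed

lemma left_cancel_mat:
  fixes W :: "'a :: field mat"
  assumes "c \<in> carrier_mat s m" "W \<in> carrier_mat s s" "det W \<noteq> 0" "W * c = 0\<^sub>m s m"
  shows "c = 0\<^sub>m s m"
proof -
  obtain V where V: "V \<in> carrier_mat s s" "V * W = 1\<^sub>m s"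
    using nonzero_det_inverse[OF assms(2,3)] by blast
  have "V * (W * c) = c" using assoc_mult_mat[OF V(1) assms(2,1)] V(2) assms(1) by simp
  then show ?thesis using assms(4) V(1) by simp
qed

text \<open>Comparing corners in the commutation with \<open>diag(0, W)\<close> gives
  \<open>b * W = 0\<close> and \<open>W * c = 0\<close>, and \<open>W\<close> is invertible. So
  whatever commutes with \<open>Q\<close> respects the Fitting splitting.\<close>

lemma commutant_block_diag:
  fixes X :: "complex mat"
  assumes n: "n = r + s" and S: "S \<in> carrier_mat n n" and T: "T \<in> carrier_mat n n" and ST: "S * T = 1\<^sub>m n"
    and W: "W \<in> carrier_mat s s" "det W \<noteq> 0"
    and Q: "Q \<in> carrier_mat n n" "T * Q * S = four_block_mat (0\<^sub>m r r) (0\<^sub>m r s) (0\<^sub>m s r) W"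
    and X: "X \<in> carrier_mat n n" "X * Q = Q * X"
  shows "\<exists>a d. a \<in> carrier_mat r r \<and> d \<in> carrier_mat s s \<and>
    T * X * S = four_block_mat a (0\<^sub>m r s) (0\<^sub>m s r) d"
proof -
  obtain a b c d where "split_block (T * X * S) r r = (a, b, c, d)"
    by (cases "split_block (T * X * S) r r") auto
  from split_block[OF this, of s s] S T n
  have a: "a \<in> carrier_mat r r" and b: "b \<in> carrier_mat r s" and c: "c \<in> carrier_mat s r"
    and d: "d \<in> carrier_mat s s" and eq: "T * X * S = four_block_mat a b c d" by auto
  have "(T * X * S) * (T * Q * S) = (T * Q * S) * (T * X * S)"
    unfolding conj_mult_mat[OF S T X(1) Q(1) ST, symmetric] conj_mult_mat[OF S T Q(1) X(1) ST, symmetric]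
    X(2) ..
  moreover have "(T * X * S) * (T * Q * S) = four_block_mat (0\<^sub>m r r) (b * W) (0\<^sub>m s r) (d * W)"
    unfolding eq Q(2)
    by (subst mult_four_block_mat[OF a b c d zero_carrier_mat zero_carrier_mat zero_carrier_mat W(1)],
        intro cong_four_block_mat) (use a b c d W in simp_all)
  moreover have "(T * Q * S) * (T * X * S) = four_block_mat (0\<^sub>m r r) (0\<^sub>m r s) (W * c) (W * d)"
    unfolding eq Q(2)
    by (subst mult_four_block_mat[OF zero_carrier_mat zero_carrier_mat zero_carrier_mat W(1) a b c d],
        intro cong_four_block_mat) (use a b c d W in simp_all)
  ultimately have "four_block_mat (0\<^sub>m r r) (b * W) (0\<^sub>m s r) (d * W)
      = four_block_mat (0\<^sub>m r r) (0\<^sub>m r s) (W * c) (W * d)" by simp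
  note inj = four_block_mat_inject[OF zero_carrier_mat zero_carrier_mat
    mult_carrier_mat[OF b W(1)] zero_carrier_mat zero_carrier_mat mult_carrier_mat[OF W(1) c]
    mult_carrier_mat[OF d W(1)] mult_carrier_mat[OF W(1) d] this]
  have "b = 0\<^sub>m r s" by (rule right_cancel_mat[OF b W inj(2)])
  moreover have "c = 0\<^sub>m s r" by (rule left_cancel_mat[OF c W inj(3)[symmetric]])
  ultimately show ?thesis using a d eq by blast
qed

lemma conj_block_anticomm:
  fixes X :: "complex mat"
  assumes n: "n = r + s" and S: "S \<in> carrier_mat n n" and T: "T \<in> carrier_mat n n" and ST: "S * T = 1\<^sub>m n"
    and X: "X \<in> carrier_mat n n" "a \<in> carrier_mat r r" "d \<in> carrier_mat s s"
      "T * X * S = four_block_mat a (0\<^sub>m r s) (0\<^sub>m s r) d"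
    and Y: "Y \<in> carrier_mat n n" "a' \<in> carrier_mat r r" "d' \<in> carrier_mat s s"
      "T * Y * S = four_block_mat a' (0\<^sub>m r s) (0\<^sub>m s r) d'"
    and anti: "X * Y = - (Y * X)"
  shows "a * a' = - (a' * a)" "d * d' = - (d' * d)"
proof -
  have "T * (X * Y) * S = four_block_mat (a * a') (0\<^sub>m r s) (0\<^sub>m s r) (d * d')"
    unfolding conj_mult_mat[OF S T X(1) Y(1) ST] X(4) Y(4) by (rule mult_block_diag_mat[OF X(2,3) Y(2,3)])
  moreover have "T * (X * Y) * S = - (T * (Y * X) * S)"
    unfolding anti using S T X(1) Y(1) by simp
  moreover have "- (T * (Y * X) * S) = four_block_mat (- (a' * a)) (0\<^sub>m r s) (0\<^sub>m s r) (- (d' * d))"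
    unfolding conj_mult_mat[OF S T Y(1) X(1) ST] X(4) Y(4) mult_block_diag_mat[OF Y(2,3) X(2,3)]
    by (rule uminus_block_diag_mat) (use X Y in auto)
  ultimately have eq: "four_block_mat (a * a') (0\<^sub>m r s) (0\<^sub>m s r) (d * d')
    = four_block_mat (- (a' * a)) (0\<^sub>m r s) (0\<^sub>m s r) (- (d' * d))" by simp
  have c: "a * a' \<in> carrier_mat r r" "- (a' * a) \<in> carrier_mat r r"
    "d * d' \<in> carrier_mat s s" "- (d' * d) \<in> carrier_mat s s" using X Y by auto
  note inj = four_block_mat_inject[OF c(1,2) zero_carrier_mat zero_carrier_mat
    zero_carrier_mat zero_carrier_mat c(3,4) eq]
  show "a * a' = - (a' * a)" "d * d' = - (d' * d)" by (rule inj(1), rule inj(4))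
qed

text \<open>Since \<open>M\<close> is neither invertible nor nilpotent, both parts of its Fitting
  splitting are nonzero, and every \<open>e i\<close> preserves them. A nonzero
  \<open>e i * e i\<close> survives on at least one part; \<open>J\<close> and \<open>K\<close> may
  overlap, which is harmless for an upper bound on \<open>card I\<close>.\<close>

lemma anticomm_on_split:
  fixes e :: "'i \<Rightarrow> complex mat"
  assumes fam: "anticomm_on n I e" and M: "M \<in> carrier_mat n n"
    and comm: "\<And>i. i \<in> I \<Longrightarrow> e i * M = M * e i"
    and det: "det M = 0" and M0: "M ^\<^sub>m n \<noteq> 0\<^sub>m n n"
  shows "\<exists>r s J K a d. n = r + s \<and> 0 < r \<and> 0 < s \<and> I = J \<union> K \<and>
    anticomm_on r J (a :: 'i \<Rightarrow> complex mat) \<and> anticomm_on s K (d :: 'i \<Rightarrow> complex mat)"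
proof -
  note car = anticomm_onD(1)[OF fam]
  obtain r s S T W where n: "n = r + s" and S: "S \<in> carrier_mat n n" and T: "T \<in> carrier_mat n n"
    and ST: "S * T = 1\<^sub>m n" "T * S = 1\<^sub>m n" and W: "W \<in> carrier_mat s s" "det W \<noteq> 0"
    and Q: "T * (M ^\<^sub>m n) * S = four_block_mat (0\<^sub>m r r) (0\<^sub>m r s) (0\<^sub>m s r) W"
    using fitting_decomposition[OF M] by metis
  note Mn = pow_carrier_mat[OF M, of n]
  \<comment> \<open>Without an invertible part \<open>M ^ n\<close> would vanish; without a
    nilpotent part, excluded next, it would be invertible.\<close>
  have "0 < s"
  proof (rule ccontr)
    assume "\<not> 0 < s"
    then have s: "s = 0" by simp
    then have "W = 0\<^sub>m s s" using W(1) by (intro eq_matI) auto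
    then have "T * (M ^\<^sub>m n) * S = 0\<^sub>m (r + s) (r + s)" unfolding Q by simp
    then have "T * (M ^\<^sub>m n) * S = 0\<^sub>m n n" unfolding n[symmetric] .
    then show False using conj_eq_zero_iff[OF S T Mn ST(1)] M0 by blast
  qed
  moreover have "0 < r"
  proof (rule ccontr)
    assume "\<not> 0 < r"
    then have r: "r = 0" by simp
    have "four_block_mat (0\<^sub>m r r) (0\<^sub>m r s) (0\<^sub>m s r) W = W" using W(1) r by (intro eq_matI) auto
    then have "det W = det T * det (M ^\<^sub>m n) * det S"
      using Q det_mult[OF mult_carrier_mat[OF T Mn] S] det_mult[OF T Mn] by simp
    moreover have "0 < n" using \<open>0 < s\<close> n by simp
    ultimately show False using det W(2) by (simp add: det_pow_mat[OF M])
  qed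
  moreover have "\<forall>i\<in>I. \<exists>a d. a \<in> carrier_mat r r \<and> d \<in> carrier_mat s s \<and>
      T * e i * S = four_block_mat a (0\<^sub>m r s) (0\<^sub>m s r) d"
    using commutant_block_diag[OF n S T ST(1) W Mn Q car commute_pow_mat[OF car M comm]] by blast
  then obtain a d where a: "\<And>i. i \<in> I \<Longrightarrow> a i \<in> carrier_mat r r"
    and d: "\<And>i. i \<in> I \<Longrightarrow> d i \<in> carrier_mat s s"
    and ad: "\<And>i. i \<in> I \<Longrightarrow> T * e i * S = four_block_mat (a i) (0\<^sub>m r s) (0\<^sub>m s r) (d i)"
    by metis
  define J where "J = {i\<in>I. a i * a i \<noteq> 0\<^sub>m r r}"
  define K where "K = {i\<in>I. d i * d i \<noteq> 0\<^sub>m s s}"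
  have "i \<in> J \<union> K" if i: "i \<in> I" for i
  proof (rule ccontr)
    assume "i \<notin> J \<union> K"
    then have z: "a i * a i = 0\<^sub>m r r" "d i * d i = 0\<^sub>m s s" using i by (auto simp: J_def K_def)
    have "T * (e i * e i) * S = four_block_mat (a i * a i) (0\<^sub>m r s) (0\<^sub>m s r) (d i * d i)"
      unfolding conj_mult_mat[OF S T car[OF i] car[OF i] ST(1)] ad[OF i]
      by (rule mult_block_diag_mat[OF a[OF i] d[OF i] a[OF i] d[OF i]])
    also have "\<dots> = 0\<^sub>m n n" unfolding z n by simp
    finally show False
      using conj_eq_zero_iff[OF S T mult_carrier_mat[OF car[OF i] car[OF i]] ST(1)]
        anticomm_onD(2)[OF fam i] by blast
  qed
  then have "I = J \<union> K" by (auto simp: J_def K_def)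
  moreover have "a i * a j = - (a j * a i) \<and> d i * d j = - (d j * d i)"
    if ij: "i \<in> I" "j \<in> I" "i \<noteq> j" for i j
    using conj_block_anticomm[OF n S T ST(1) car[OF ij(1)] a[OF ij(1)] d[OF ij(1)] ad[OF ij(1)]
        car[OF ij(2)] a[OF ij(2)] d[OF ij(2)] ad[OF ij(2)] anticomm_onD(3)[OF fam ij]] by blast
  then have "anticomm_on r J a" "anticomm_on s K d"
    using a d unfolding anticomm_on_def J_def K_def by blast+
  ultimately show ?thesis using n by blast
qed

section \<open>Families with two invertible members\<close>

lemma smult_smult_mat: "k \<cdot>\<^sub>m (l \<cdot>\<^sub>m A) = (k * l :: 'a :: semigroup_mult) \<cdot>\<^sub>m A"
  by (intro eq_matI) (auto simp: mult.assoc)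

lemma one_smult_mat: "(1 :: 'a :: monoid_mult) \<cdot>\<^sub>m A = A"
  by (intro eq_matI) auto

lemma mult_scalar_mat:
  fixes A :: "'a :: comm_semiring_1 mat"
  assumes "A \<in> carrier_mat n m"
  shows "A * (c \<cdot>\<^sub>m 1\<^sub>m m) = c \<cdot>\<^sub>m A" "(c \<cdot>\<^sub>m 1\<^sub>m n) * A = c \<cdot>\<^sub>m A"
  using mult_smult_distrib[OF assms one_carrier_mat, of c]
    mult_smult_assoc_mat[OF one_carrier_mat assms, of c] assms by simp_all

text \<open>\<open>X\<close> and \<open>X + c\<close> are coprime polynomials, so powers of
  \<open>A\<close> and \<open>B\<close> cannot both kill a nonzero \<open>g\<close>. Instead of a
  Bezout identity, induction on \<open>i\<close> gives \<open>g * A = 0\<close>, hence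
  \<open>g * B = c g\<close>, and \<open>g * B ^ j = c ^ j g\<close> forces
  \<open>g = 0\<close>.\<close>

lemma annihilator_coprime_shift:
  fixes A :: "complex mat"
  assumes A: "A \<in> carrier_mat n n" and c: "c \<noteq> 0" and B: "B = A + c \<cdot>\<^sub>m 1\<^sub>m n"
    and gB: "g * B ^\<^sub>m j = 0\<^sub>m n n"
  shows "g \<in> carrier_mat n n \<Longrightarrow> g * A ^\<^sub>m i = 0\<^sub>m n n \<Longrightarrow> g = 0\<^sub>m n n"
  using gB
proof (induction i arbitrary: g)
  case 0 then show ?case using A by simp
next
  case (Suc i)
  note g = Suc.prems(1)
  have Bc: "B \<in> carrier_mat n n" using A B by simp
  note Ai = pow_carrier_mat[OF A, of i] and Bj = pow_carrier_mat[OF Bc, of j]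
  have "A * B = A * A + c \<cdot>\<^sub>m A"
    unfolding B using A by (simp add: mult_add_distrib_mat[OF A A, of "c \<cdot>\<^sub>m 1\<^sub>m n"] mult_scalar_mat[OF A])
  moreover have "B * A = A * A + c \<cdot>\<^sub>m A"
    unfolding B using A by (simp add: add_mult_distrib_mat[OF A _ A] mult_scalar_mat[OF A])
  ultimately have AB: "A * B = B * A" by simp
  have gA: "g * A = 0\<^sub>m n n"
  proof (rule Suc.IH)
    have "(g * A) * A ^\<^sub>m i = g * (A * A ^\<^sub>m i)" by (rule assoc_mult_mat[OF g A Ai])
    also have "A * A ^\<^sub>m i = A ^\<^sub>m i * A" by (rule commute_pow_mat[OF A A refl])
    finally show "(g * A) * A ^\<^sub>m i = 0\<^sub>m n n" using Suc.prems(2) by simp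
    have "(g * A) * B ^\<^sub>m j = g * (A * B ^\<^sub>m j)" by (rule assoc_mult_mat[OF g A Bj])
    also have "A * B ^\<^sub>m j = B ^\<^sub>m j * A" by (rule commute_pow_mat[OF A Bc AB])
    also have "g * (B ^\<^sub>m j * A) = (g * B ^\<^sub>m j) * A" by (rule assoc_mult_mat[OF g Bj A, symmetric])
    also have "\<dots> = 0\<^sub>m n n" unfolding Suc.prems(3) using A by simp
    finally show "(g * A) * B ^\<^sub>m j = 0\<^sub>m n n" .
  qed (use g A in simp)
  have gB: "g * B = c \<cdot>\<^sub>m g"
    unfolding B using A g gA by (simp add: mult_add_distrib_mat[OF g A, of "c \<cdot>\<^sub>m 1\<^sub>m n"] mult_scalar_mat[OF g])
  have "g * B ^\<^sub>m k = c ^ k \<cdot>\<^sub>m g" for k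
  proof (induction k)
    case 0 then show ?case using g Bc by (simp add: one_smult_mat)
  next
    case (Suc k)
    have "g * (B ^\<^sub>m k * B) = (g * B ^\<^sub>m k) * B"
      by (rule assoc_mult_mat[OF g pow_carrier_mat[OF Bc] Bc, symmetric])
    also have "\<dots> = c ^ k \<cdot>\<^sub>m (c \<cdot>\<^sub>m g)" unfolding Suc mult_smult_assoc_mat[OF g Bc] gB ..
    finally show ?case by (simp add: smult_smult_mat mult.commute)
  qed
  then have z: "c ^ j \<cdot>\<^sub>m g = 0\<^sub>m n n" using Suc.prems(3) by simp
  show ?case
  proof (rule eq_matI)
    fix a b assume "a < dim_row (0\<^sub>m n n)" "b < dim_col (0\<^sub>m n n)"
    then have ab: "a < n" "b < n" by auto
    have "(c ^ j \<cdot>\<^sub>m g) $$ (a, b) = 0" unfolding z using ab by simp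
    then show "g $$ (a, b) = 0\<^sub>m n n $$ (a, b)" using ab g c by simp
  qed (use g in auto)
qed

text \<open>Each factor moved past \<open>F\<close> contributes one sign. With
  \<open>A = E - \<mu>\<close> and \<open>B = E + \<mu>\<close> this expresses that \<open>F\<close>
  exchanges the generalised eigenspaces of \<open>E\<close> for \<open>\<mu>\<close> and
  \<open>-\<mu>\<close>.\<close>

lemma anticomm_intertwine_pow:
  fixes F :: "complex mat"
  assumes F: "F \<in> carrier_mat n n" and A: "A \<in> carrier_mat n n" and B: "B \<in> carrier_mat n n"
    and FA: "F * A = - (B * F)"
  shows "F * A ^\<^sub>m k = (- 1) ^ k \<cdot>\<^sub>m (B ^\<^sub>m k * F)"
proof (induction k)
  case 0 then show ?case using F A B by (intro eq_matI) auto
next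
  case (Suc k)
  note Ak = pow_carrier_mat[OF A, of k] and Bk = pow_carrier_mat[OF B, of k]
  have BkF: "B ^\<^sub>m k * F \<in> carrier_mat n n" using Bk F by simp
  have "F * (A ^\<^sub>m k * A) = (F * A ^\<^sub>m k) * A" by (rule assoc_mult_mat[OF F Ak A, symmetric])
  also have "\<dots> = (- 1) ^ k \<cdot>\<^sub>m (B ^\<^sub>m k * F * A)" unfolding Suc by (rule mult_smult_assoc_mat[OF BkF A])
  also have "B ^\<^sub>m k * F * A = B ^\<^sub>m k * (F * A)" by (rule assoc_mult_mat[OF Bk F A])
  also have "\<dots> = - (B ^\<^sub>m k * (B * F))" unfolding FA using Bk B F by simp
  also have "B ^\<^sub>m k * (B * F) = B ^\<^sub>m k * B * F" by (rule assoc_mult_mat[OF Bk B F, symmetric])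
  also have "(- 1) ^ k \<cdot>\<^sub>m - (B ^\<^sub>m k * B * F) = (- 1) ^ Suc k \<cdot>\<^sub>m (B ^\<^sub>m k * B * F)"
    using B F by (intro eq_matI) auto
  finally show ?case by simp
qed

text \<open>For invertible members \<open>E\<close>, \<open>F\<close> the products \<open>E F e\<^sub>i\<close> anticommute among themselves and commute
  with \<open>E\<close>; hence they act on its generalised eigenspaces, which are exchanged by \<open>F\<close>.\<close>

lemma anticomm_on_invertible_pair:
  fixes e :: "'i \<Rightarrow> complex mat"
  assumes fam: "anticomm_on n I e" and pq: "p \<in> I" "q \<in> I" "p \<noteq> q"
    and dE: "det (e p) \<noteq> 0" and dF: "det (e q) \<noteq> 0" and n: "0 < n"
    and \<mu>: "det (char_matrix (e p) \<mu>) = 0"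
    and nil: "det (char_matrix (e p * e p) (\<mu> * \<mu>)) = 0
      \<Longrightarrow> char_matrix (e p * e p) (\<mu> * \<mu>) ^\<^sub>m n = 0\<^sub>m n n"
  shows "\<exists>s d. 0 < s \<and> 2 * s \<le> n \<and> anticomm_on s (I - {p, q}) (d :: 'i \<Rightarrow> complex mat)"
proof -
  note car = anticomm_onD(1)[OF fam]
  define E where "E = e p"
  define F where "F = e q"
  have E: "E \<in> carrier_mat n n" and F: "F \<in> carrier_mat n n" using car pq by (auto simp: E_def F_def)
  have FE: "F * E = - (E * F)" unfolding E_def F_def using anticomm_onD(3)[OF fam pq(2,1)] pq(3) by simp
  \<comment> \<open>\<open>A * B\<close> is the square of \<open>E\<close> minus that of
    \<open>\<mu>\<close>, nilpotent through \<open>nil\<close>; \<open>A\<close> and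
    \<open>B\<close> differ by the nonzero scalar \<open>2 * \<mu>\<close>.\<close>
  define A where "A = E + (- \<mu>) \<cdot>\<^sub>m 1\<^sub>m n"
  define B where "B = E + \<mu> \<cdot>\<^sub>m 1\<^sub>m n"
  have A: "A \<in> carrier_mat n n" and B: "B \<in> carrier_mat n n" using E by (auto simp: A_def B_def)
  have Acm: "char_matrix E \<mu> = A" using E by (simp add: char_matrix_def A_def)
  have \<mu>0: "\<mu> \<noteq> 0"
  proof
    assume "\<mu> = 0"
    then have "A = E" using E by (intro eq_matI) (auto simp: A_def)
    then show False using \<mu> dE Acm by (simp add: E_def)
  qed
  have BA: "B = A + (2 * \<mu>) \<cdot>\<^sub>m 1\<^sub>m n" using E by (intro eq_matI) (auto simp: A_def B_def)
  have o: "c \<cdot>\<^sub>m 1\<^sub>m n \<in> carrier_mat n n" for c :: complex by simp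
  have ABx: "(E + x \<cdot>\<^sub>m 1\<^sub>m n) * (E + y \<cdot>\<^sub>m 1\<^sub>m n) = E * E + (x + y) \<cdot>\<^sub>m E + (x * y) \<cdot>\<^sub>m 1\<^sub>m n" for x y
  proof -
    have "(E + x \<cdot>\<^sub>m 1\<^sub>m n) * (E + y \<cdot>\<^sub>m 1\<^sub>m n)
      = (E * E + E * (y \<cdot>\<^sub>m 1\<^sub>m n)) + ((x \<cdot>\<^sub>m 1\<^sub>m n) * E + (x \<cdot>\<^sub>m 1\<^sub>m n) * (y \<cdot>\<^sub>m 1\<^sub>m n))"
      unfolding add_mult_distrib_mat[OF E o add_carrier_mat[OF o]]
        mult_add_distrib_mat[OF E E o] mult_add_distrib_mat[OF o E o] ..
    also have "E * (y \<cdot>\<^sub>m 1\<^sub>m n) = y \<cdot>\<^sub>m E" using E by (simp add: mult_scalar_mat[OF E])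
    also have "(x \<cdot>\<^sub>m 1\<^sub>m n) * E = x \<cdot>\<^sub>m E" using E by (simp add: mult_scalar_mat[OF E])
    also have "(x \<cdot>\<^sub>m 1\<^sub>m n) * (y \<cdot>\<^sub>m 1\<^sub>m n) = (x * y) \<cdot>\<^sub>m 1\<^sub>m n"
      by (simp add: mult_scalar_mat[OF o] smult_smult_mat mult.commute)
    finally show ?thesis using E by (intro eq_matI) (auto simp: algebra_simps)
  qed
  have AB: "A * B = char_matrix (E * E) (\<mu> * \<mu>)"
    unfolding A_def B_def ABx char_matrix_def using E by (intro eq_matI) auto
  have BA': "A * B = B * A" unfolding A_def B_def ABx by (simp add: ac_simps)
  have AnBn: "A ^\<^sub>m n * B ^\<^sub>m n = 0\<^sub>m n n"
  proof -
    have "det (A * B) = 0" using det_mult[OF A B] \<mu> Acm by (simp add: E_def)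
    then show ?thesis
      unfolding pow_mat_mult_commute[OF A B BA', symmetric] AB using nil by (simp add: E_def)
  qed
  have FA: "F * A = - (B * F)"
  proof -
    have "F * A = F * E + (- \<mu>) \<cdot>\<^sub>m F"
      unfolding A_def mult_add_distrib_mat[OF F E o] using F by (simp add: mult_scalar_mat[OF F])
    moreover have "B * F = E * F + \<mu> \<cdot>\<^sub>m F"
      unfolding B_def add_mult_distrib_mat[OF E o F] using F by (simp add: mult_scalar_mat[OF F])
    ultimately show ?thesis unfolding FE using E F by (intro eq_matI) auto
  qed
  note An = pow_carrier_mat[OF A, of n] and Bn = pow_carrier_mat[OF B, of n]
  have FAn: "F * A ^\<^sub>m n = (- 1) ^ n \<cdot>\<^sub>m (B ^\<^sub>m n * F)" by (rule anticomm_intertwine_pow[OF F A B FA])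
  \<comment> \<open>\<open>F\<close> intertwines the two powers and is invertible, so
    \<open>g * A ^ n = 0\<close> implies \<open>g * B ^ n = 0\<close>, and coprimality applies. Thus
    a \<open>g\<close> commuting with \<open>F\<close> is zero once it vanishes on the image of
    \<open>A ^ n\<close>.\<close>
  have kill: "g = 0\<^sub>m n n" if g: "g \<in> carrier_mat n n" "g * F = F * g" "g * A ^\<^sub>m n = 0\<^sub>m n n" for g
  proof (rule annihilator_coprime_shift[OF A _ BA _ g(1,3)])
    have "(- 1) ^ n \<cdot>\<^sub>m (g * B ^\<^sub>m n * F) = g * (F * A ^\<^sub>m n)"
      unfolding FAn mult_smult_distrib[OF g(1) mult_carrier_mat[OF Bn F]] assoc_mult_mat[OF g(1) Bn F] ..
    also have "\<dots> = (g * F) * A ^\<^sub>m n" by (rule assoc_mult_mat[OF g(1) F An, symmetric])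
    also have "\<dots> = F * (g * A ^\<^sub>m n)" unfolding g(2) by (rule assoc_mult_mat[OF F g(1) An])
    also have "\<dots> = 0\<^sub>m n n" unfolding g(3) using F by simp
    finally have z: "(- 1) ^ n \<cdot>\<^sub>m (g * B ^\<^sub>m n * F) = 0\<^sub>m n n" .
    have "g * B ^\<^sub>m n * F = (- 1) ^ n \<cdot>\<^sub>m ((- 1) ^ n \<cdot>\<^sub>m (g * B ^\<^sub>m n * F))"
      by (simp add: smult_smult_mat one_smult_mat flip: power_mult_distrib)
    then have "g * B ^\<^sub>m n * F = 0\<^sub>m n n" unfolding z by simp
    then show "g * B ^\<^sub>m n = 0\<^sub>m n n"
      by (rule right_cancel_mat[OF mult_carrier_mat[OF g(1) Bn] F dF[folded F_def]])
  qed (use \<mu>0 in simp)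
  obtain r s S T W where rs: "n = r + s" and S: "S \<in> carrier_mat n n" and T: "T \<in> carrier_mat n n"
    and ST: "S * T = 1\<^sub>m n" "T * S = 1\<^sub>m n" and W: "W \<in> carrier_mat s s" "det W \<noteq> 0"
    and Q: "T * (A ^\<^sub>m n) * S = four_block_mat (0\<^sub>m r r) (0\<^sub>m r s) (0\<^sub>m s r) W"
    using fitting_decomposition[OF A] by metis
  have "0 < s"
  proof (rule ccontr)
    assume "\<not> 0 < s"
    then have s: "s = 0" by simp
    then have "W = 0\<^sub>m s s" using W(1) by (intro eq_matI) auto
    then have "T * (A ^\<^sub>m n) * S = 0\<^sub>m (r + s) (r + s)" unfolding Q by simp
    then have "T * (A ^\<^sub>m n) * S = 0\<^sub>m n n" unfolding rs[symmetric] .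
    then have "A ^\<^sub>m n = 0\<^sub>m n n" using conj_eq_zero_iff[OF S T An ST(1)] by blast
    then have "1\<^sub>m n = (0\<^sub>m n n :: complex mat)" using kill[of "1\<^sub>m n"] F An by simp
    then have "(1\<^sub>m n :: complex mat) $$ (0, 0) = 0\<^sub>m n n $$ (0, 0)" by simp
    then show False using n by simp
  qed
  \<comment> \<open>\<open>A ^ n * B ^ n = 0\<close> forces \<open>h2 = 0\<close>, and intertwining
    then makes the lower right block \<open>d\<close> of \<open>F\<close> vanish. The lower right
    block of \<open>F * G = 1\<close> becomes \<open>c * b' = 1\<close> with \<open>c\<close> of
    size \<open>s\<close> by \<open>r\<close>.\<close>
  have "s \<le> r"
  proof -
    obtain h1 h2 where h: "h1 \<in> carrier_mat r r" "h2 \<in> carrier_mat s s"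
      "T * B ^\<^sub>m n * S = four_block_mat h1 (0\<^sub>m r s) (0\<^sub>m s r) h2"
    proof -
      have "A * B ^\<^sub>m n = B ^\<^sub>m n * A" by (rule commute_pow_mat[OF A B BA'])
      then have "B ^\<^sub>m n * A ^\<^sub>m n = A ^\<^sub>m n * B ^\<^sub>m n" using commute_pow_mat[OF Bn A] by simp
      then show ?thesis using commutant_block_diag[OF rs S T ST(1) W An Q Bn] that by blast
    qed
    have "four_block_mat (0\<^sub>m r r * h1) (0\<^sub>m r s) (0\<^sub>m s r) (W * h2) = T * (A ^\<^sub>m n * B ^\<^sub>m n) * S"
      unfolding conj_mult_mat[OF S T An Bn ST(1)] Q h(3)
      by (rule mult_block_diag_mat[OF zero_carrier_mat W(1) h(1,2), symmetric])
    also have "\<dots> = 0\<^sub>m n n" unfolding AnBn using S T by simp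
    finally have "four_block_mat (0\<^sub>m r r * h1) (0\<^sub>m r s) (0\<^sub>m s r) (W * h2) = 0\<^sub>m (r + s) (r + s)"
      unfolding rs[symmetric] .
    then have "W * h2 = 0\<^sub>m s s"
      using block_diag_eq_zero_iff[OF mult_carrier_mat[OF zero_carrier_mat h(1)] mult_carrier_mat[OF W(1) h(2)]]
      by blast
    then have h2: "h2 = 0\<^sub>m s s" by (rule left_cancel_mat[OF h(2) W])
    obtain a b c d where "split_block (T * F * S) r r = (a, b, c, d)"
      by (cases "split_block (T * F * S) r r") auto
    from split_block[OF this, of s s] S T rs
    have abcd: "a \<in> carrier_mat r r" "b \<in> carrier_mat r s" "c \<in> carrier_mat s r" "d \<in> carrier_mat s s"
      and eq: "T * F * S = four_block_mat a b c d" by auto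
    have "(T * F * S) * (T * A ^\<^sub>m n * S) = (- 1) ^ n \<cdot>\<^sub>m ((T * B ^\<^sub>m n * S) * (T * F * S))"
      unfolding conj_mult_mat[OF S T F An ST(1), symmetric] conj_mult_mat[OF S T Bn F ST(1), symmetric] FAn
      mult_smult_distrib[OF T mult_carrier_mat[OF Bn F]]
      mult_smult_assoc_mat[OF mult_carrier_mat[OF T mult_carrier_mat[OF Bn F]] S] ..
    moreover have "(T * F * S) * (T * A ^\<^sub>m n * S) = four_block_mat (0\<^sub>m r r) (b * W) (0\<^sub>m s r) (d * W)"
      unfolding eq Q
      by (subst mult_four_block_mat[OF abcd zero_carrier_mat zero_carrier_mat zero_carrier_mat W(1)],
          intro cong_four_block_mat) (use abcd W in simp_all)
    moreover have "(T * B ^\<^sub>m n * S) * (T * F * S) = four_block_mat (h1 * a) (h1 * b) (0\<^sub>m s r) (0\<^sub>m s s)"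
      unfolding eq h(3) h2
      by (subst mult_four_block_mat[OF h(1) zero_carrier_mat zero_carrier_mat zero_carrier_mat abcd],
          intro cong_four_block_mat) (use abcd h in simp_all)
    ultimately have "four_block_mat (0\<^sub>m r r) (b * W) (0\<^sub>m s r) (d * W)
        = (- 1) ^ n \<cdot>\<^sub>m four_block_mat (h1 * a) (h1 * b) (0\<^sub>m s r) (0\<^sub>m s s)" by simp
    also have "\<dots> = four_block_mat ((- 1) ^ n \<cdot>\<^sub>m (h1 * a)) ((- 1) ^ n \<cdot>\<^sub>m (h1 * b)) (0\<^sub>m s r) (0\<^sub>m s s)"
      by (subst smult_four_block_mat[of _ r r _ s _ s]) (use abcd h in auto)
    finally have "d * W = 0\<^sub>m s s"
      by (rule four_block_mat_inject(4)[rotated 8]) (use abcd W h in auto)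
    then have d0: "d = 0\<^sub>m s s" by (rule right_cancel_mat[OF abcd(4) W])
    obtain G where G: "G \<in> carrier_mat n n" "F * G = 1\<^sub>m n"
      using nonzero_det_inverse[OF F dF[folded F_def]] by blast
    obtain a' b' c' d' where "split_block (T * G * S) r r = (a', b', c', d')"
      by (cases "split_block (T * G * S) r r") auto
    from split_block[OF this, of s s] S T rs
    have abcd': "a' \<in> carrier_mat r r" "b' \<in> carrier_mat r s" "c' \<in> carrier_mat s r" "d' \<in> carrier_mat s s"
      and eq': "T * G * S = four_block_mat a' b' c' d'" by auto
    have "four_block_mat a b c d * four_block_mat a' b' c' d' = T * (F * G) * S"
      unfolding eq[symmetric] eq'[symmetric] by (rule conj_mult_mat[OF S T F G(1) ST(1), symmetric])
    also have "\<dots> = 1\<^sub>m n" unfolding G(2) using T ST(2) by simp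
    also have "\<dots> = four_block_mat (1\<^sub>m r) (0\<^sub>m r s) (0\<^sub>m s r) (1\<^sub>m s)" using rs by simp
    finally have "c * b' + d * d' = 1\<^sub>m s"
      unfolding mult_four_block_mat[OF abcd abcd']
      by (rule four_block_mat_inject(4)[rotated 8]) (use abcd abcd' in auto)
    then have "c * b' = 1\<^sub>m s" using abcd abcd' by (simp add: d0)
    then show ?thesis by (rule right_inverse_imp_le_dim[OF abcd(3) abcd'(2)])
  qed
  \<comment> \<open>\<open>E * F\<close> anticommutes with \<open>E\<close> and with
    \<open>F\<close> but commutes with the other members, so each \<open>f i\<close> commutes with
    both \<open>E\<close> and \<open>F\<close>.\<close>
  define C where "C = E * F"
  have C: "C \<in> carrier_mat n n" using E F by (simp add: C_def)
  define f where "f = (\<lambda>i. C * e i)"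
  note as = assoc_mult_mat[of _ n n _ n _ n]
  have CE: "C * E = - (E * C)"
  proof -
    have "C * E = E * (F * E)" unfolding C_def by (rule as[OF E F E])
    then show ?thesis unfolding FE C_def using E F by simp
  qed
  have CF: "C * F = - (F * C)"
  proof -
    have "F * C = (F * E) * F" unfolding C_def by (rule as[OF F E F, symmetric])
    then have "F * C = - (C * F)" unfolding FE C_def using E F by simp
    then show ?thesis by simp
  qed
  have anti2: "(X * Y) * Z = Z * (X * Y)"
    if c: "X \<in> carrier_mat n n" "Y \<in> carrier_mat n n" "Z \<in> carrier_mat n n"
      and XZ: "X * Z = - (Z * X)" and YZ: "Y * Z = - (Z * Y)" for X Y Z :: "complex mat"
  proof -
    have "(X * Y) * Z = X * (Y * Z)" by (rule as[OF c])
    also have "\<dots> = - (X * (Z * Y))" unfolding YZ using c by simp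
    also have "X * (Z * Y) = (X * Z) * Y" by (rule as[OF c(1,3,2), symmetric])
    also have "\<dots> = - (Z * X * Y)" unfolding XZ using c by (simp del: assoc_mult_mat)
    also have "- (- (Z * X * Y)) = Z * X * Y" by simp
    also have "\<dots> = Z * (X * Y)" by (rule as[OF c(3,1,2)])
    finally show ?thesis .
  qed
  define I' where "I' = I - {p, q}"
  have I': "i \<in> I" "i \<noteq> p" "i \<noteq> q" if "i \<in> I'" for i using that by (auto simp: I'_def)
  have f: "f i \<in> carrier_mat n n" if "i \<in> I'" for i using car[OF I'(1)[OF that]] C by (simp add: f_def)
  have eE: "e i * E = - (E * e i)" if i: "i \<in> I'" for i
    unfolding E_def using anticomm_onD(3)[OF fam I'(1)[OF i] pq(1) I'(2)[OF i]] .
  have eF: "e i * F = - (F * e i)" if i: "i \<in> I'" for i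
    unfolding F_def using anticomm_onD(3)[OF fam I'(1)[OF i] pq(2) I'(3)[OF i]] .
  have eC: "C * e i = e i * C" if i: "i \<in> I'" for i
  proof -
    have "E * e i = - (e i * E)" "F * e i = - (e i * F)" using eE[OF i] eF[OF i] by simp_all
    then show ?thesis unfolding C_def by (rule anti2[OF E F car[OF I'(1)[OF i]]])
  qed
  have fE: "f i * E = E * f i" if i: "i \<in> I'" for i
    unfolding f_def by (rule anti2[OF C car[OF I'(1)[OF i]] E CE eE[OF i]])
  have fF: "f i * F = F * f i" if i: "i \<in> I'" for i
    unfolding f_def by (rule anti2[OF C car[OF I'(1)[OF i]] F CF eF[OF i]])
  \<comment> \<open>Extracting the invertible factor \<open>C * C\<close> transfers anticommutation
    and nonzero squares from \<open>e\<close> to \<open>f\<close>.\<close>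
  have ff: "f i * f j = (C * C) * (e i * e j)" if ij: "i \<in> I'" "j \<in> I'" for i j
  proof -
    note ci = car[OF I'(1)[OF ij(1)]] and cj = car[OF I'(1)[OF ij(2)]]
    have "f i * f j = C * ((e i * C) * e j)" unfolding f_def using C ci cj by (simp add: as)
    also have "e i * C = C * e i" by (rule eC[OF ij(1), symmetric])
    also have "C * (C * e i * e j) = (C * C) * (e i * e j)" using C ci cj by (simp add: as)
    finally show ?thesis .
  qed
  have ff_anti: "f i * f j = - (f j * f i)" if ij: "i \<in> I'" "j \<in> I'" "i \<noteq> j" for i j
  proof -
    note ci = car[OF I'(1)[OF ij(1)]] and cj = car[OF I'(1)[OF ij(2)]]
    have ee: "e i * e j = - (e j * e i)" by (rule anticomm_onD(3)[OF fam I'(1)[OF ij(1)] I'(1)[OF ij(2)] ij(3)])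
    show ?thesis unfolding ff[OF ij(1,2)] ff[OF ij(2,1)] ee using C ci cj by (simp del: assoc_mult_mat)
  qed
  have detCC: "det (C * C) \<noteq> 0"
    using dE dF det_mult[OF C C] det_mult[OF E F] by (simp add: C_def E_def F_def)
  have ff0: "f i * f i \<noteq> 0\<^sub>m n n" if i: "i \<in> I'" for i
  proof
    assume "f i * f i = 0\<^sub>m n n"
    note ci = car[OF I'(1)[OF i]]
    have "e i * e i = 0\<^sub>m n n"
      by (rule left_cancel_mat[OF mult_carrier_mat[OF ci ci] mult_carrier_mat[OF C C] detCC])
        (use \<open>f i * f i = 0\<^sub>m n n\<close> ff[OF i i] in simp)
    then show False using anticomm_onD(2)[OF fam I'(1)[OF i]] by simp
  qed
  have fA: "f i * A = A * f i" if i: "i \<in> I'" for i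
    unfolding A_def mult_add_distrib_mat[OF f[OF i] E o] add_mult_distrib_mat[OF E o f[OF i]] fE[OF i]
    using f[OF i] by (simp add: mult_scalar_mat[OF f[OF i]])
  have "\<forall>i\<in>I'. \<exists>a d. a \<in> carrier_mat r r \<and> d \<in> carrier_mat s s \<and>
      T * f i * S = four_block_mat a (0\<^sub>m r s) (0\<^sub>m s r) d"
    using commutant_block_diag[OF rs S T ST(1) W An Q f commute_pow_mat[OF f A fA]] by blast
  then obtain a d where a: "\<And>i. i \<in> I' \<Longrightarrow> a i \<in> carrier_mat r r"
    and d: "\<And>i. i \<in> I' \<Longrightarrow> d i \<in> carrier_mat s s"
    and ad: "\<And>i. i \<in> I' \<Longrightarrow> T * f i * S = four_block_mat (a i) (0\<^sub>m r s) (0\<^sub>m s r) (d i)"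
    by metis
  have d_anti: "d i * d j = - (d j * d i)" if ij: "i \<in> I'" "j \<in> I'" "i \<noteq> j" for i j
    by (rule conj_block_anticomm(2)[OF rs S T ST(1) f[OF ij(1)] a[OF ij(1)] d[OF ij(1)] ad[OF ij(1)]
        f[OF ij(2)] a[OF ij(2)] d[OF ij(2)] ad[OF ij(2)] ff_anti[OF ij]])
  \<comment> \<open>Restriction to the \<open>s\<close>-part loses no square: if
    \<open>d i * d i = 0\<close>, then \<open>g = f i * f i\<close> satisfies
    \<open>g * A ^ n = 0\<close> and commutes with \<open>F\<close>, so \<open>kill\<close> gives
    \<open>g = 0\<close>.\<close>
  have d0: "d i * d i \<noteq> 0\<^sub>m s s" if i: "i \<in> I'" for i
  proof
    assume z: "d i * d i = 0\<^sub>m s s"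
    define g where "g = f i * f i"
    have g: "g \<in> carrier_mat n n" using f[OF i] by (simp add: g_def)
    have gF: "g * F = F * g"
    proof -
      have "g * F = f i * (f i * F)" unfolding g_def by (rule as[OF f[OF i] f[OF i] F])
      also have "\<dots> = (f i * F) * f i" unfolding fF[OF i] by (rule as[OF f[OF i] F f[OF i], symmetric, unfolded fF[OF i]])
      also have "\<dots> = F * g" unfolding fF[OF i] g_def by (rule as[OF F f[OF i] f[OF i]])
      finally show ?thesis .
    qed
    have "T * g * S = four_block_mat (a i * a i) (0\<^sub>m r s) (0\<^sub>m s r) (d i * d i)"
      unfolding g_def conj_mult_mat[OF S T f[OF i] f[OF i] ST(1)] ad[OF i]
      by (rule mult_block_diag_mat[OF a[OF i] d[OF i] a[OF i] d[OF i]])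
    then have Tg: "T * g * S = four_block_mat (a i * a i) (0\<^sub>m r s) (0\<^sub>m s r) (0\<^sub>m s s)" unfolding z .
    have "T * (g * A ^\<^sub>m n) * S = four_block_mat (a i * a i * 0\<^sub>m r r) (0\<^sub>m r s) (0\<^sub>m s r) (0\<^sub>m s s * W)"
      unfolding conj_mult_mat[OF S T g An ST(1)] Tg Q
      by (rule mult_block_diag_mat[OF mult_carrier_mat[OF a[OF i] a[OF i]] zero_carrier_mat zero_carrier_mat W(1)])
    also have "\<dots> = 0\<^sub>m n n" using a[OF i] W rs by simp
    finally have "g * A ^\<^sub>m n = 0\<^sub>m n n"
      using conj_eq_zero_iff[OF S T mult_carrier_mat[OF g An] ST(1)] by blast
    from kill[OF g gF this] ff0[OF i] show False by (simp add: g_def)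
  qed
  have "anticomm_on s I' d" using d d0 d_anti unfolding anticomm_on_def by blast
  then show ?thesis using \<open>0 < s\<close> \<open>s \<le> r\<close> rs unfolding I'_def by (intro exI[of _ s] exI[of _ d]) simp
qed

section \<open>Upper bound\<close>

definition alpha_value :: "nat \<Rightarrow> nat" where
  "alpha_value n = (if n \<in> {1, 2} then 2 * n - 1 else if n \<in> {3, 4} then 2 * n - 2 else 2 * n - 3)"

text \<open>The value is \<open>2 * n\<close> minus a defect: 1 up to 2, 2 up to 4, 3 beyond. Two
  defects 1 occur only for \<open>r + s \<le> 4\<close>; all other pairs add up to at least 3.
  Equality at 2 + 1 and 2 + 2 explains the exceptional values at 3 and 4.\<close>

lemma alpha_value_superadditive:
  "0 < r \<Longrightarrow> 0 < s \<Longrightarrow> alpha_value r + alpha_value s \<le> alpha_value (r + s)"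
  unfolding alpha_value_def by auto

lemma pow_mat_add:
  fixes A :: "'a :: semiring_1 mat"
  assumes A: "A \<in> carrier_mat n n"
  shows "A ^\<^sub>m (k + l) = A ^\<^sub>m k * A ^\<^sub>m l"
proof (induction l)
  case 0 then show ?case using A by simp
next
  case (Suc l)
  show ?case
    using assoc_mult_mat[OF pow_carrier_mat[OF A, of k] pow_carrier_mat[OF A, of l] A] Suc by simp
qed

lemma eigenvalue_exists:
  fixes A :: "complex mat"
  assumes A: "A \<in> carrier_mat n n" and n: "0 < n"
  shows "\<exists>\<mu>. det (char_matrix A \<mu>) = 0"
proof -
  from char_poly_factorized[OF A] obtain as
    where as: "char_poly A = (\<Prod>a\<leftarrow>as. [:- a, 1:])" "length as = n" by blast
  then obtain \<mu> bs where "as = \<mu> # bs" using n by (cases as) auto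
  then have "poly (char_poly A) \<mu> = 0" unfolding as by simp
  then show ?thesis using eigenvalue_root_char_poly[OF A] eigenvalue_det[OF A] by blast
qed

lemma anticomm_on_card_le:
  fixes e :: "'i \<Rightarrow> complex mat"
  assumes "0 < n" "finite I" "anticomm_on n I e"
  shows "card I \<le> alpha_value n"
  using assms
proof (induction n arbitrary: I e rule: less_induct)
  case (less n)
  note n = less.prems(1) and fin = less.prems(2) and fam = less.prems(3)
  note car = anticomm_onD(1)[OF fam]
  show ?case
  \<comment> \<open>A shifted square that is singular but not nilpotent signals an eigenvalue
    \<open>x\<close> together with a different one.\<close>
  proof (cases "\<exists>i\<in>I. \<exists>x. det (char_matrix (e i * e i) x) = 0 \<and> char_matrix (e i * e i) x ^\<^sub>m n \<noteq> 0\<^sub>m n n")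
    case True
    then obtain p x where p: "p \<in> I"
      and dM: "det (char_matrix (e p * e p) x) = 0" "char_matrix (e p * e p) x ^\<^sub>m n \<noteq> 0\<^sub>m n n" by blast
    note cp = car[OF p]
    have o: "- x \<cdot>\<^sub>m 1\<^sub>m n \<in> carrier_mat n n" by simp
    have pp: "e p * e p \<in> carrier_mat n n" using cp by simp
    have M: "char_matrix (e p * e p) x = e p * e p + (- x) \<cdot>\<^sub>m 1\<^sub>m n"
      using cp by (simp add: char_matrix_def)
    have comm: "e i * char_matrix (e p * e p) x = char_matrix (e p * e p) x * e i" if i: "i \<in> I" for i
    proof -
      note ci = car[OF i]
      have "e i * (e p * e p) = e p * e p * e i"
      proof (cases "i = p")
        case True then show ?thesis using assoc_mult_mat[OF cp cp cp] by simp
      next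
        case False
        have 1: "e i * e p = - (e p * e i)" by (rule anticomm_onD(3)[OF fam i p False])
        have "e i * (e p * e p) = (e i * e p) * e p" by (rule assoc_mult_mat[OF ci cp cp, symmetric])
        also have "\<dots> = - (e p * e i * e p)" unfolding 1 using ci cp by (simp del: assoc_mult_mat)
        also have "e p * e i * e p = e p * (e i * e p)" by (rule assoc_mult_mat[OF cp ci cp])
        also have "\<dots> = - (e p * (e p * e i))" unfolding 1 using ci cp by (simp del: assoc_mult_mat)
        also have "e p * (e p * e i) = e p * e p * e i" by (rule assoc_mult_mat[OF cp cp ci, symmetric])
        finally show ?thesis by simp
      qed
      then show ?thesis
        unfolding M mult_add_distrib_mat[OF ci pp o] add_mult_distrib_mat[OF pp o ci] mult_scalar_mat[OF ci]
        by simp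
    qed
    have "char_matrix (e p * e p) x \<in> carrier_mat n n" unfolding M using cp by simp
    from anticomm_on_split[OF fam this comm dM]
    obtain r s J K and a d :: "'i \<Rightarrow> complex mat" where rs: "n = r + s" "0 < r" "0 < s"
      and JK: "I = J \<union> K" and ad: "anticomm_on r J a" "anticomm_on s K d" by blast
    have "finite J" "finite K" using fin JK by auto
    then have "card J \<le> alpha_value r" "card K \<le> alpha_value s"
      using less.IH[of r J a] less.IH[of s K d] rs ad by auto
    moreover have "card I \<le> card J + card K" unfolding JK by (rule card_Un_le)
    moreover have "alpha_value r + alpha_value s \<le> alpha_value n"
      unfolding rs(1) by (rule alpha_value_superadditive[OF rs(2,3)])
    ultimately show ?thesis by linarith
  next
    case False
    then have nil: "char_matrix (e i * e i) x ^\<^sub>m n = 0\<^sub>m n n"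
      if "i \<in> I" "det (char_matrix (e i * e i) x) = 0" for i x using that by blast
    define N where "N = {i\<in>I. det (e i) = 0}"
    show ?thesis
    \<comment> \<open>With at most one invertible member, all others have a singular, hence
      nilpotent, square. Either none of these exist and \<open>card I \<le> 1\<close>, or the
      nilpotent bound plus one applies.\<close>
    proof (cases "card (I - N) \<le> Suc 0")
      case True
      have NI: "N \<subseteq> I" and finN: "finite N" using fin by (auto simp: N_def)
      have cN: "card I = card N + card (I - N)" 
        using card_Diff_subset[OF finN NI] card_mono[OF fin NI] by linarith
      have "e i ^\<^sub>m (n + n) = 0\<^sub>m n n" if i: "i \<in> N" for i
      proof -
        have iI: "i \<in> I" and di: "det (e i) = 0" using i by (auto simp: N_def)
        note ci = car[OF iI]
        have "char_matrix (e i * e i) 0 = e i * e i"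
          using ci by (intro eq_matI) (auto simp: char_matrix_def)
        moreover have "det (e i * e i) = 0" using det_mult[OF ci ci] di by simp
        ultimately have "(e i * e i) ^\<^sub>m n = 0\<^sub>m n n" using nil[OF iI, of 0] by simp
        then show ?thesis unfolding pow_mat_mult_commute[OF ci ci refl] pow_mat_add[OF ci] .
      qed
      then have "N = {} \<or> card N + 4 \<le> 2 * n"
        using nilpotent_anticomm_card[OF anticomm_on_subset[OF fam NI] finN] by metis
      then have "card N = 0 \<or> card N + 4 \<le> 2 * n" by (metis card.empty)
      then have "card I \<le> 1 \<or> card I + 3 \<le> 2 * n" using True cN by linarith
      then show ?thesis using n by (auto simp: alpha_value_def)
    next
      case False
      then obtain p q where pq: "p \<in> I" "q \<in> I" "p \<noteq> q" "det (e p) \<noteq> 0" "det (e q) \<noteq> 0"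
        using card_le_Suc0_iff_eq[of "I - N"] fin unfolding N_def by blast
      obtain \<mu> where \<mu>: "det (char_matrix (e p) \<mu>) = 0" using eigenvalue_exists[OF car[OF pq(1)] n] by blast
      from anticomm_on_invertible_pair[OF fam pq n \<mu> nil[OF pq(1)]]
      obtain s and d :: "'i \<Rightarrow> complex mat" where s: "0 < s" "2 * s \<le> n" "anticomm_on s (I - {p, q}) d" by blast
      have "card (I - {p, q}) \<le> alpha_value s" using less.IH[OF _ s(1) _ s(3)] s fin by auto
      moreover have "card (I - {p, q}) = card I - 2" using pq fin by (simp add: card_Diff_subset)
      \<comment> \<open>Two members were set aside, so
        \<open>card I \<le> 2 + (2 * s - 1) \<le> n + 1\<close>. Here \<open>n\<close> is at least 2
        because \<open>s\<close> is positive, and then \<open>n + 1\<close> does not exceed the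
        claimed value.\<close>
      moreover have "alpha_value s \<le> 2 * s - 1" by (auto simp: alpha_value_def)
      moreover have "n + 1 \<le> alpha_value n" using s by (auto simp: alpha_value_def)
      ultimately show ?thesis using s by linarith
    qed
  qed
qed

section \<open>Constructions\<close>

text \<open>Both families are extended by zero on the other summand. Members of different families
  have product zero in either order, hence anticommute.\<close>

lemma anticomm_family_direct_sum:
  assumes e: "anticomm_family r k e" and f: "anticomm_family s l f"
  shows "\<exists>g. anticomm_family (r + s) (k + l) g"
proof -
  have e: "\<And>i. i < k \<Longrightarrow> e i \<in> carrier_mat r r" "\<And>i. i < k \<Longrightarrow> e i * e i \<noteq> 0\<^sub>m r r"
    "\<And>i j. i < k \<Longrightarrow> j < k \<Longrightarrow> i \<noteq> j \<Longrightarrow> e i * e j = - (e j * e i)"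
    using e unfolding anticomm_family_def by blast+
  have f: "\<And>i. i < l \<Longrightarrow> f i \<in> carrier_mat s s" "\<And>i. i < l \<Longrightarrow> f i * f i \<noteq> 0\<^sub>m s s"
    "\<And>i j. i < l \<Longrightarrow> j < l \<Longrightarrow> i \<noteq> j \<Longrightarrow> f i * f j = - (f j * f i)"
    using f unfolding anticomm_family_def by blast+
  define g where "g = (\<lambda>i. if i < k then four_block_mat (e i) (0\<^sub>m r s) (0\<^sub>m s r) (0\<^sub>m s s)
    else four_block_mat (0\<^sub>m r r) (0\<^sub>m r s) (0\<^sub>m s r) (f (i - k)))"
  define a where "a = (\<lambda>i. if i < k then e i else 0\<^sub>m r r)"
  define d where "d = (\<lambda>i. if i < k then 0\<^sub>m s s else f (i - k))"
  have a: "a i \<in> carrier_mat r r" if "i < k + l" for i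
    using e(1) that by (simp add: a_def)
  have d: "d i \<in> carrier_mat s s" if "i < k + l" for i
    using f(1) that by (simp add: d_def)
  have g: "g i = four_block_mat (a i) (0\<^sub>m r s) (0\<^sub>m s r) (d i)" for i
    by (simp add: g_def a_def d_def)
  have gg: "g i * g j = four_block_mat (a i * a j) (0\<^sub>m r s) (0\<^sub>m s r) (d i * d j)"
    if "i < k + l" "j < k + l" for i j
    unfolding g by (rule mult_block_diag_mat[OF a[OF that(1)] d[OF that(1)] a[OF that(2)] d[OF that(2)]])
  have "g i \<in> carrier_mat (r + s) (r + s)" if "i < k + l" for i
    unfolding g using a[OF that] d[OF that] by simp
  moreover have "g i * g i \<noteq> 0\<^sub>m (r + s) (r + s)" if i: "i < k + l" for i
  proof -
    have "a i * a i \<noteq> 0\<^sub>m r r \<or> d i * d i \<noteq> 0\<^sub>m s s"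
      using e(2)[of i] f(2)[of "i - k"] i by (cases "i < k") (simp_all add: a_def d_def)
    then show ?thesis
      unfolding gg[OF i i] using a[OF i] d[OF i] by (subst block_diag_eq_zero_iff) auto
  qed
  moreover have "g i * g j = - (g j * g i)" if ij: "i < k + l" "j < k + l" "i \<noteq> j" for i j
  proof -
    have "a i * a j = - (a j * a i)"
    proof (cases "i < k \<and> j < k")
      case True
      then have "e i * e j = - (e j * e i)" using e(3) ij(3) by blast
      then show ?thesis unfolding a_def using True by (simp only: if_True)
    next
      case False
      then show ?thesis using a[OF ij(1)] a[OF ij(2)] by (auto simp: a_def uminus_zero_mat)
    qed
    moreover have "d i * d j = - (d j * d i)"
    proof (cases "k \<le> i \<and> k \<le> j")
      case True
      then have "i - k < l" "j - k < l" "i - k \<noteq> j - k" using ij by auto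
      then have "f (i - k) * f (j - k) = - (f (j - k) * f (i - k))" by (rule f(3))
      then show ?thesis unfolding d_def using True by (simp only: not_less[symmetric] if_False)
    next
      case False
      then show ?thesis using d[OF ij(1)] d[OF ij(2)] by (auto simp: d_def uminus_zero_mat)
    qed
    ultimately show ?thesis
      unfolding gg[OF ij(1,2)] gg[OF ij(2,1)]
      using uminus_block_diag_mat[OF mult_carrier_mat[OF a[OF ij(2)] a[OF ij(1)]]
          mult_carrier_mat[OF d[OF ij(2)] d[OF ij(1)]]] by simp
  qed
  ultimately show ?thesis unfolding anticomm_family_def by blast
qed

lemma anticomm_family_1: "\<exists>e. anticomm_family 1 1 e"
proof -
  have "1\<^sub>m 1 \<noteq> (0\<^sub>m 1 1 :: complex mat)"
  proof
    assume "1\<^sub>m 1 = (0\<^sub>m 1 1 :: complex mat)"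
    then have "(1\<^sub>m 1 :: complex mat) $$ (0, 0) = 0\<^sub>m 1 1 $$ (0, 0)" by simp
    then show False by simp
  qed
  then show ?thesis by (intro exI[of _ "\<lambda>_. 1\<^sub>m 1"]) (simp add: anticomm_family_def)
qed

section \<open>Explicit families\<close>

definition mat2 :: "complex \<Rightarrow> complex \<Rightarrow> complex \<Rightarrow> complex \<Rightarrow> complex mat" where
  "mat2 a b c d = mat 2 2 (\<lambda>(i, j). if i = 0 then if j = 0 then a else b else if j = 0 then c else d)"

lemma mat2_mult: "mat2 a b c d * mat2 a' b' c' d'
    = mat2 (a * a' + b * c') (a * b' + b * d') (c * a' + d * c') (c * b' + d * d')"
  by (intro eq_matI) (auto simp: mat2_def scalar_prod_def numeral_2_eq_2 less_Suc_eq)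

lemma uminus_mat2: "- mat2 a b c d = mat2 (- a) (- b) (- c) (- d)"
  by (intro eq_matI) (auto simp: mat2_def)

text \<open>Testing the upper left entry suffices for the matrices below, whose squares are plus or
  minus the identity.\<close>

lemma mat2_nonzero: "a \<noteq> 0 \<Longrightarrow> mat2 a b c d \<noteq> 0\<^sub>m 2 2"
proof
  assume "a \<noteq> 0" "mat2 a b c d = 0\<^sub>m 2 2"
  then have "mat2 a b c d $$ (0, 0) = 0\<^sub>m 2 2 $$ (0, 0)" by simp
  then show False using \<open>a \<noteq> 0\<close> by (simp add: mat2_def)
qed

text \<open>Pauli matrices up to scalars; the last one is multiplied by the imaginary unit to make
  its entries real.\<close>

lemma anticomm_family_pauli: "\<exists>e. anticomm_family 2 3 e"
proof -
  define e where "e = (\<lambda>i :: nat. if i = 0 then mat2 0 1 1 0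
    else if i = 1 then mat2 1 0 0 (- 1) else mat2 0 1 (- 1) 0)"
  have "mat2 a b c d \<in> carrier_mat 2 2" for a b c d by (simp add: mat2_def)
  then have "anticomm_family 2 3 e"
    unfolding anticomm_family_def
    by (auto simp: e_def mat2_mult uminus_mat2 mat2_nonzero numeral_3_eq_3 less_Suc_eq)
  then show ?thesis by blast
qed

text \<open>For different \<open>l\<close> the products of the \<open>g\<close> vanish; for equal
  \<open>l\<close> the product is a corner unit times the second sign, so opposite signs
  anticommute. Every nonzero entry of \<open>g\<close> joins an outer and a middle index, where
  \<open>D\<close> has opposite signs, so \<open>D\<close> anticommutes with all of them.\<close>

lemma anticomm_family_nilpotent_plus_one:
  assumes n: "3 \<le> n"
  shows "\<exists>e. anticomm_family n (2 * n - 3) e"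
proof -
  define g where "g = (\<lambda>l \<sigma>. mat n n (\<lambda>(i, j).
    (if i = 0 \<and> j = l then 1 else if i = l \<and> j = n - 1 then \<sigma> else 0 :: complex)))"
  define D where "D = mat n n (\<lambda>(i, j).
    (if i = j then if i = 0 \<or> i = n - 1 then 1 else - 1 else 0 :: complex))"
  define z where "z = (\<lambda>\<sigma>. mat n n (\<lambda>(i, j). if i = 0 \<and> j = n - 1 then \<sigma> else 0 :: complex))"
  have g: "g l \<sigma> \<in> carrier_mat n n" for l \<sigma> by (simp add: g_def)
  have D: "D \<in> carrier_mat n n" by (simp add: D_def)
  have gg: "g l \<sigma> * g m \<tau> = (if l = m then z \<tau> else 0\<^sub>m n n)"
    if l: "0 < l" "l < n - 1" and m: "0 < m" "m < n - 1" for l m \<sigma> \<tau>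
  proof (rule eq_matI)
    fix i j assume "i < dim_row (if l = m then z \<tau> else 0\<^sub>m n n)" "j < dim_col (if l = m then z \<tau> else 0\<^sub>m n n)"
    then have ij: "i < n" "j < n" by (auto simp: z_def split: if_splits)
    have "(g l \<sigma> * g m \<tau>) $$ (i, j) = (\<Sum>t<n. g l \<sigma> $$ (i, t) * g m \<tau> $$ (t, j))"
      using ij g by (auto simp: scalar_prod_def atLeast0LessThan g_def)
    also have "\<dots> = (\<Sum>t<n. if t = l then (if i = 0 \<and> l = m \<and> j = n - 1 then \<tau> else 0) else 0)"
      using ij l m by (intro sum.cong refl) (auto simp: g_def)
    also have "\<dots> = (if l = m then z \<tau> else 0\<^sub>m n n) $$ (i, j)" using ij l by (auto simp: z_def)
    finally show "(g l \<sigma> * g m \<tau>) $$ (i, j) = (if l = m then z \<tau> else 0\<^sub>m n n) $$ (i, j)" .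
  qed (auto simp: z_def g_def)
  have z0: "z \<sigma> \<noteq> 0\<^sub>m n n" if "\<sigma> \<noteq> 0" for \<sigma>
  proof
    assume "z \<sigma> = 0\<^sub>m n n"
    then have "z \<sigma> $$ (0, n - 1) = 0\<^sub>m n n $$ (0, n - 1)" by simp
    then show False using that n by (simp add: z_def)
  qed
  have uz: "- z \<sigma> = z (- \<sigma>)" for \<sigma> by (intro eq_matI) (auto simp: z_def)
  have entD: "(D * X) $$ (i, j) = D $$ (i, i) * X $$ (i, j)" "(X * D) $$ (i, j) = X $$ (i, j) * D $$ (j, j)"
    if "X \<in> carrier_mat n n" "i < n" "j < n" for X i j
  proof -
    have "(D * X) $$ (i, j) = (\<Sum>t<n. D $$ (i, t) * X $$ (t, j))"
      using that D by (auto simp: scalar_prod_def atLeast0LessThan)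
    also have "\<dots> = (\<Sum>t<n. if t = i then D $$ (i, i) * X $$ (i, j) else 0)"
      using that by (intro sum.cong refl) (auto simp: D_def)
    finally show "(D * X) $$ (i, j) = D $$ (i, i) * X $$ (i, j)" using that by simp
    have "(X * D) $$ (i, j) = (\<Sum>t<n. X $$ (i, t) * D $$ (t, j))"
      using that D by (auto simp: scalar_prod_def atLeast0LessThan)
    also have "\<dots> = (\<Sum>t<n. if t = j then X $$ (i, j) * D $$ (j, j) else 0)"
      using that by (intro sum.cong refl) (auto simp: D_def)
    finally show "(X * D) $$ (i, j) = X $$ (i, j) * D $$ (j, j)" using that by simp
  qed
  have Dg: "D * g l \<sigma> = - (g l \<sigma> * D)" if l: "0 < l" "l < n - 1" for l \<sigma>
  proof (rule eq_matI)
    fix i j assume "i < dim_row (- (g l \<sigma> * D))" "j < dim_col (- (g l \<sigma> * D))"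
    then have ij: "i < n" "j < n" by (auto simp: g_def D_def)
    then have "(- (g l \<sigma> * D)) $$ (i, j) = - ((g l \<sigma> * D) $$ (i, j))"
      by (intro index_uminus_mat(1)) (simp_all add: g_def D_def)
    then show "(D * g l \<sigma>) $$ (i, j) = (- (g l \<sigma> * D)) $$ (i, j)"
      unfolding entD[OF g ij] using ij l by (auto simp: g_def D_def)
  qed (simp_all add: g_def D_def)
  have DD: "D * D \<noteq> 0\<^sub>m n n"
  proof
    assume "D * D = 0\<^sub>m n n"
    then have "(D * D) $$ (0, 0) = 0\<^sub>m n n $$ (0, 0)" by simp
    then show False using entD(1)[OF D, of 0 0] n by (simp add: D_def)
  qed
  \<comment> \<open>An index below \<open>2 * n - 4\<close> encodes a middle position in
    \<open>1, ..., n - 2\<close> by its half and a sign by its parity; the index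
    \<open>2 * n - 4\<close> remains for \<open>D\<close>.\<close>
  define L where "L = (\<lambda>i :: nat. i div 2 + 1)"
  define \<epsilon> where "\<epsilon> = (\<lambda>i :: nat. if even i then 1 else - 1 :: complex)"
  define e where "e = (\<lambda>i. if i < 2 * n - 4 then g (L i) (\<epsilon> i) else D)"
  have L: "0 < L i" "L i < n - 1" if "i < 2 * n - 4" for i using that n by (auto simp: L_def)
  have \<epsilon>0: "\<epsilon> i \<noteq> 0" for i by (simp add: \<epsilon>_def)
  have L\<epsilon>: "\<epsilon> j = - \<epsilon> i" if "L i = L j" "i \<noteq> j" for i j
  proof -
    have "i div 2 = j div 2" using that by (simp add: L_def)
    then have "i mod 2 \<noteq> j mod 2" using that(2) by (metis div_mult_mod_eq)
    then show ?thesis by (auto simp: \<epsilon>_def even_iff_mod_2_eq_zero)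
  qed
  have "e i \<in> carrier_mat n n" for i using g D by (simp add: e_def)
  moreover have "e i * e i \<noteq> 0\<^sub>m n n" for i
    using DD gg[OF L[of i] L[of i], of "\<epsilon> i" "\<epsilon> i"] z0[OF \<epsilon>0[of i]] by (auto simp: e_def)
  moreover have "e i * e j = - (e j * e i)"
    if ij: "i < 2 * n - 3" "j < 2 * n - 3" "i \<noteq> j" for i j
  proof -
    consider "i < 2 * n - 4" "j < 2 * n - 4" | "i < 2 * n - 4" "j = 2 * n - 4"
      | "i = 2 * n - 4" "j < 2 * n - 4" using ij by linarith
    then show ?thesis
    proof cases
      case 1
      show ?thesis
        using 1 gg[OF L[OF 1(1)] L[OF 1(2)], of "\<epsilon> i" "\<epsilon> j"] gg[OF L[OF 1(2)] L[OF 1(1)], of "\<epsilon> j" "\<epsilon> i"]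
          L\<epsilon>[OF _ ij(3)] by (auto simp: e_def uz uminus_zero_mat)
    next
      case 2
      then show ?thesis using Dg[OF L[OF 2(1)], of "\<epsilon> i"] by (simp add: e_def)
    next
      case 3
      then show ?thesis using Dg[OF L[OF 3(2)], of "\<epsilon> j"] by (simp add: e_def)
    qed
  qed
  ultimately show ?thesis unfolding anticomm_family_def by blast
qed

text \<open>For sizes 3 and 4 the general construction falls one short; direct sums of sizes 2 + 1
  and 2 + 2 attain the value.\<close>

lemma anticomm_family_alpha_value:
  assumes "1 \<le> n"
  shows "\<exists>e. anticomm_family n (alpha_value n) e"
proof -
  consider "n = 1" | "n = 2" | "n = 3" | "n = 4" | "5 \<le> n" using assms by linarith
  then show ?thesis
  proof cases
    case 1 then show ?thesis using anticomm_family_1 by (simp add: alpha_value_def)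
  next
    case 2 then show ?thesis using anticomm_family_pauli by (simp add: alpha_value_def)
  next
    case 3
    from anticomm_family_pauli anticomm_family_1 obtain e f
      where "anticomm_family 2 3 e" "anticomm_family 1 1 f" by blast
    from anticomm_family_direct_sum[OF this] show ?thesis using 3 by (simp add: alpha_value_def)
  next
    case 4
    from anticomm_family_pauli obtain e where "anticomm_family 2 3 e" by blast
    from anticomm_family_direct_sum[OF this this] show ?thesis using 4 by (simp add: alpha_value_def)
  next
    case 5
    then show ?thesis using anticomm_family_nilpotent_plus_one[of n] by (simp add: alpha_value_def)
  qed
qed

theorem theorem5p2:
  fixes n :: nat
  assumes "n \<ge> 1"
  shows "alpha n = (if n \<in> {1, 2} then 2 * n - 1
                    else if n \<in> {3, 4} then 2 * n - 2
                    else 2 * n - 3)"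
proof -
  have "k \<le> alpha_value n" if "\<exists>e. anticomm_family n k e" for k
  proof -
    from that obtain e where "anticomm_family n k e" by blast
    then have "anticomm_on n {..<k} e" unfolding anticomm_family_def anticomm_on_def by blast
    then show ?thesis using anticomm_on_card_le[of n "{..<k}" e] assms by simp
  qed
  then have "alpha n = alpha_value n"
    unfolding alpha_def using anticomm_family_alpha_value[OF assms] by (intro Greatest_equality) auto
  then show ?thesis unfolding alpha_value_def .
qed

end
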